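(* Let $k\ge 3$ and let $\mathbf w$ be a recurrent balanced weakly rich infinite word with alphabet exactly $\{1,2,\ldots,k\}$. Then, up to a permutation of the letters, $\mathbf w$ is either (1) a shift of the periodic word $\psi_1^n\circ\psi_2\circ\cdots\circ\psi_{k-1}(k^\omega)$ for some $n\ge1$; or (2) a shift of the periodic word $\sigma_1\circ\sigma_2\circ\cdots\circ\sigma_j\circ\psi_{j+1}^2\circ\psi_{j+2}\circ\cdots\circ\psi_{k-1}(k^\omega)$ for some $1\le j\le k-2$.
   Context: An infinite word $\mathbf w$ over $\mathcal A$ is weakly rich if for every letter $a\in\mathcal A$, every complete return to $a$ in $\mathbf w$ is a palindrome, where a complete return to $u$ is a factor containing exactly two occurrences of $u$, one as prefix and one as suffix. Recurrent: every factor occurs infinitely often. Balanced: for any two factors $u,v$ of equal length and any letter $x$, the numbers of occurrences of $x$ in $u$ and $v$ differ by at most 1. A shift of $\mathbf x=x_1x_2\cdots$ is a word $x_{i+1}x_{i+2}\cdots$, $i\ge0$. For a letter $a$, $\psi_a$ is the morphism $a\mapsto a$, $x\mapsto ax$ for $x\ne a$. For a letter $a$ not occurring in $\mathbf x=x_1x_2x_3\cdots$, $\sigma_a(\mathbf x)=a x_1 a^{\epsilon_1}x_2a^{\epsilon_2}x_3a^{\epsilon_3}\cdots$ where $\epsilon_i=2$ if $x_i=x_{i+1}$ and $\epsilon_i=1$ otherwise. $k^\omega$ denotes $kkk\cdots$. *)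

theory Defs
  imports
    "HOL-Library.Stream"
    "HOL-Library.Sublist"
    "HOL-Combinatorics.Permutations"
begin

text \<open>
  Infinite words are streams and finite words are lists. The alphabet of \<open>w\<close> is \<open>sset w\<close>, and
  the shift of \<open>w\<close> by \<open>i\<close> letters is \<open>sdrop i w\<close>. Positions are counted from \<open>0\<close>.
\<close>

definition factor_of :: "'a list \<Rightarrow> 'a stream \<Rightarrow> bool" where
  "factor_of u w \<longleftrightarrow> (\<exists>i. stake (length u) (sdrop i w) = u)"

definition recurrent_word :: "'a stream \<Rightarrow> bool" where
  "recurrent_word w \<longleftrightarrow>
     (\<forall>u. factor_of u w \<longrightarrow> infinite {i. stake (length u) (sdrop i w) = u})"

definition balanced_word :: "'a stream \<Rightarrow> bool" where
  "balanced_word w \<longleftrightarrow>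
     (\<forall>u v x. factor_of u w \<longrightarrow> factor_of v w \<longrightarrow> length u = length v \<longrightarrow>
        \<bar>int (count_list u x) - int (count_list v x)\<bar> \<le> 1)"

definition occurrences :: "'a list \<Rightarrow> 'a list \<Rightarrow> nat set" where
  "occurrences u v = {i. i + length u \<le> length v \<and> take (length u) (drop i v) = u}"

definition complete_return :: "'a stream \<Rightarrow> 'a list \<Rightarrow> 'a list \<Rightarrow> bool" where
  "complete_return w u v \<longleftrightarrow>
     factor_of v w \<and> card (occurrences u v) = 2 \<and> prefix u v \<and> suffix u v"

definition palindrome :: "'a list \<Rightarrow> bool" where
  "palindrome v \<longleftrightarrow> rev v = v"

definition weakly_rich :: "'a stream \<Rightarrow> bool" where
  "weakly_rich w \<longleftrightarrow> (\<forall>a \<in> sset w. \<forall>v. complete_return w [a] v \<longrightarrow> palindrome v)"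

definition periodic_word :: "'a stream \<Rightarrow> bool" where
  "periodic_word w \<longleftrightarrow> (\<exists>p>0. sdrop p w = w)"

definition shift_of :: "'a stream \<Rightarrow> 'a stream \<Rightarrow> bool" where
  "shift_of y x \<longleftrightarrow> (\<exists>i. y = sdrop i x)"

definition psi :: "'a \<Rightarrow> 'a stream \<Rightarrow> 'a stream" where
  "psi a x = flat (smap (\<lambda>b. if b = a then [a] else [a, b]) x)"

text \<open>
  \<open>sigma a x\<close> is only meaningful if \<open>a\<close> does not occur in \<open>x\<close>. The block contributed by
  position \<open>i\<close> is the letter \<open>x !! i\<close> followed by two copies of \<open>a\<close> if \<open>x !! i = x !! Suc i\<close>
  and by one copy otherwise.
\<close>

definition sigma :: "'a \<Rightarrow> 'a stream \<Rightarrow> 'a stream" where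
  "sigma a x =
     a ## flat (smap2 (\<lambda>b c. b # replicate (if b = c then 2 else 1) a) x (stl x))"

text \<open>
  The two families of words. Since \<open>foldr f [a, b] x = f a (f b x)\<close>, the leftmost index in the
  list is the outermost map, as in the composition \<open>\<psi>\<^sub>2 \<circ> \<dots> \<circ> \<psi>\<^bsub>k-1\<^esub>\<close>. In \<open>word2 k j\<close> with
  \<open>j + 2 \<le> k\<close>, every \<open>sigma i\<close> is applied to a word whose letters are all greater than \<open>i\<close>.
\<close>

definition word1 :: "nat \<Rightarrow> nat \<Rightarrow> nat stream" where
  "word1 k n = (psi 1 ^^ n) (foldr psi [2..<k] (sconst k))"

definition word2 :: "nat \<Rightarrow> nat \<Rightarrow> nat stream" where
  "word2 k j =
     foldr sigma [1..<j + 1] ((psi (j + 1) ^^ 2) (foldr psi [j + 2..<k] (sconst k)))"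

end

theory Submission
  imports Defs "HOL-Library.Infinite_Set"
begin

text \<open>
  Returns to a letter are palindromes, so a return of even length exhibits a square \<open>xx\<close> at its
  centre and a return of odd length at least 5 exhibits a factor \<open>yxy\<close>. By balance the distances
  between consecutive occurrences of a letter differ by at most one. Hence some letter \<open>a\<close> is
  separating: at least one of any two adjacent letters is \<open>a\<close>. Deleting a separating letter
  preserves balance and weak richness.

  If no square of a letter occurs, all distances are constant and even, one letter occupies every
  second position, and deleting it gives \<open>\<psi>\<^sub>1 \<circ> \<dots> \<circ> \<psi>\<^bsub>k-1\<^esub>(k\<^sup>\<omega>)\<close> inductively. If \<open>aa\<close> occurs, let \<open>v\<close>
  be the word with \<open>a\<close> deleted. If \<open>v\<close> has no squares, all runs of \<open>a\<close> are equally long, which gives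
  \<open>\<psi>\<^sub>a\<^sup>n(v)\<close>. If \<open>v\<close> contains \<open>bb\<close>, comparing the distances of \<open>b\<close> forces \<open>b a a b\<close> and \<open>b a c a b\<close> as the only
  returns to \<open>b\<close>, so the word is \<open>\<sigma>\<^sub>a(v)\<close>, and the balance of \<open>\<sigma>\<^sub>a(v)\<close> excludes all exponents but 2
  for the innermost repeated \<open>\<psi>\<close>. All of this is done up to finite prefixes; recurrence recovers the shift.
\<close>

subsection \<open>Block decompositions of streams\<close>

lemma stream_eq_snthI: "(\<And>n. x !! n = y !! n) \<Longrightarrow> x = y"
  by (metis stream.map_cong0 stream_smap_nats)

text \<open>Since no block is empty, strong induction on the position reduces a letter beyond the
  first block to a smaller position for the next state. This serves in place of coinduction.\<close>

lemma stream_eq_blocksI: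
  assumes F: "\<And>s. F s = B s @- F (nx s)" and G: "\<And>s. G s = B s @- G (nx s)"
    and B: "\<And>s. B s \<noteq> []"
  shows "F s = G s"
proof -
  have "F s !! n = G s !! n" for n
  proof (induction n arbitrary: s rule: less_induct)
    case (less n)
    show ?case
    proof (cases "n < length (B s)")
      case True
      then show ?thesis by (subst F, subst G) simp
    next
      case False
      moreover have "n - length (B s) < n" using False B[of s] by (cases "B s") auto
      ultimately show ?thesis using less[of "n - length (B s)" "nx s"]
        by (subst F, subst G) simp
    qed
  qed
  then show ?thesis by (rule stream_eq_snthI)
qed

lemma psi_unfold: "psi a x = (if shd x = a then [a] else [a, shd x]) @- psi a (stl x)"
  by (cases x) (simp add: psi_def)

text \<open>The last \<open>a\<close> of each block in the definition moves to the front of the next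
  block, so that what follows a block is again a value of \<open>sigma a\<close>.\<close>

lemma sigma_unfold:
  "sigma a x = (if shd x = shd (stl x) then [a, shd x, a] else [a, shd x]) @- sigma a (stl x)"
  by (cases x; cases "stl x") (simp add: sigma_def numeral_2_eq_2 smap2_unfold)

lemma psi_Cons: "psi a (b ## x) = (if b = a then [a] else [a, b]) @- psi a x"
  by (subst psi_unfold) simp

lemma psi_replicate_Cons:
  assumes "b \<noteq> a"
  shows "psi a ((replicate d a @ [b]) @- x) = (replicate (Suc d) a @ [b]) @- psi a x"
proof (induction d)
  case 0
  then show ?case using assms by (simp add: psi_Cons)
next
  case (Suc d)
  have "psi a ((replicate (Suc d) a @ [b]) @- x) = a ## psi a ((replicate d a @ [b]) @- x)"
    by (simp add: psi_Cons)
  then show ?case using Suc by simp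
qed

text \<open>Each application keeps the run of \<open>a\<close> already built and inserts one more
  \<open>a\<close> before the other letter.\<close>

lemma psi_pow_unfold:
  assumes "shd x \<noteq> a"
  shows "(psi a ^^ d) x = (replicate d a @ [shd x]) @- (psi a ^^ d) (stl x)"
proof (induction d)
  case (Suc d)
  then show ?case using psi_replicate_Cons[OF assms, of d] by simp
qed simp

text \<open>Dropping letters of \<open>x\<close> drops whole blocks of the image. As blocks are
  nonempty, \<open>q \<ge> i\<close>, which keeps periods positive in
  \<open>periodic_psi\<close>.\<close>

lemma psi_sdrop: "\<exists>q\<ge>i. psi a (sdrop i x) = sdrop q (psi a x)"
proof (induction i arbitrary: x)
  case 0
  show ?case by (rule exI[of _ 0]) simp
next
  case (Suc i)
  obtain q where q: "q \<ge> i" "psi a (sdrop i (stl x)) = sdrop q (psi a (stl x))"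
    using Suc by blast
  let ?B = "if shd x = a then [a] else [a, shd x]"
  have "sdrop (length ?B + q) (psi a x) = sdrop q (psi a (stl x))"
    by (subst psi_unfold) (simp add: sdrop_shift)
  then show ?case using q by (intro exI[of _ "length ?B + q"]) auto
qed

lemma sigma_sdrop: "\<exists>q\<ge>i. sigma a (sdrop i x) = sdrop q (sigma a x)"
proof (induction i arbitrary: x)
  case 0
  show ?case by (rule exI[of _ 0]) simp
next
  case (Suc i)
  obtain q where q: "q \<ge> i" "sigma a (sdrop i (stl x)) = sdrop q (sigma a (stl x))"
    using Suc by blast
  let ?B = "if shd x = shd (stl x) then [a, shd x, a] else [a, shd x]"
  have "sdrop (length ?B + q) (sigma a x) = sdrop q (sigma a (stl x))"
    by (subst sigma_unfold) (simp add: sdrop_shift)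
  then show ?case using q by (intro exI[of _ "length ?B + q"]) auto
qed

section \<open>Periodicity of the words in the two families\<close>

lemma periodic_sconst: "periodic_word (sconst c)"
  unfolding periodic_word_def by (rule exI[of _ 1]) simp

lemma periodic_psi: "periodic_word x \<Longrightarrow> periodic_word (psi a x)"
  unfolding periodic_word_def by (metis psi_sdrop order_less_le_trans)

lemma periodic_sigma: "periodic_word x \<Longrightarrow> periodic_word (sigma a x)"
  unfolding periodic_word_def by (metis sigma_sdrop order_less_le_trans)

lemma periodic_psi_pow: "periodic_word x \<Longrightarrow> periodic_word ((psi a ^^ n) x)"
  by (induction n) (simp_all add: periodic_psi)

lemma periodic_foldr_psi: "periodic_word x \<Longrightarrow> periodic_word (foldr psi L x)"
  by (induction L) (simp_all add: periodic_psi)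

lemma periodic_foldr_sigma: "periodic_word x \<Longrightarrow> periodic_word (foldr sigma L x)"
  by (induction L) (simp_all add: periodic_sigma)

section \<open>Compatibility of the maps with relabelling of letters\<close>

lemma smap_psi:
  assumes "inj h"
  shows "smap h (psi a x) = psi (h a) (smap h x)"
proof (rule stream_eq_blocksI[where nx = stl and
      B = "\<lambda>x. if shd x = a then [h a] else [h a, h (shd x)]"])
  fix s
  show "smap h (psi a s) =
      (if shd s = a then [h a] else [h a, h (shd s)]) @- smap h (psi a (stl s))"
    by (subst psi_unfold) simp
  show "psi (h a) (smap h s) =
      (if shd s = a then [h a] else [h a, h (shd s)]) @- psi (h a) (smap h (stl s))"
    by (subst psi_unfold) (simp add: inj_eq[OF assms])
qed simp

lemma smap_sigma:
  assumes "inj h"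
  shows "smap h (sigma a x) = sigma (h a) (smap h x)"
proof (rule stream_eq_blocksI[where nx = stl and
      B = "\<lambda>x. map h (if shd x = shd (stl x) then [a, shd x, a] else [a, shd x])"])
  fix s
  show "smap h (sigma a s) = map h (if shd s = shd (stl s) then [a, shd s, a] else [a, shd s])
      @- smap h (sigma a (stl s))"
    by (subst sigma_unfold) simp
  show "sigma (h a) (smap h s) = map h (if shd s = shd (stl s) then [a, shd s, a] else [a, shd s])
      @- sigma (h a) (smap h (stl s))"
    by (subst sigma_unfold) (simp add: inj_eq[OF assms])
qed simp

lemma smap_psi_pow: "inj h \<Longrightarrow> smap h ((psi a ^^ n) x) = (psi (h a) ^^ n) (smap h x)"
  by (induction n) (simp_all add: smap_psi)

lemma smap_foldr_psi: "inj h \<Longrightarrow> smap h (foldr psi L x) = foldr psi (map h L) (smap h x)"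
  by (induction L) (simp_all add: smap_psi)

lemma smap_foldr_sigma: "inj h \<Longrightarrow> smap h (foldr sigma L x) = foldr sigma (map h L) (smap h x)"
  by (induction L) (simp_all add: smap_sigma)

lemma smap_sconst: "smap h (sconst c) = sconst (h c)"
proof (rule stream_eq_blocksI[where F = "\<lambda>_. smap h (sconst c)" and G = "\<lambda>_. sconst (h c)"
      and nx = "\<lambda>u. u" and B = "\<lambda>_::unit. [h c]" and s = "()"])
  show "smap h (sconst c) = [h c] @- smap h (sconst c)" by (subst siterate.code) simp
  show "sconst (h c) = [h c] @- sconst (h c)" by (subst siterate.code) simp
qed simp

section \<open>Equality up to finite prefixes\<close>

definition tail_eq :: "'a stream \<Rightarrow> 'a stream \<Rightarrow> bool" where
  "tail_eq x y \<longleftrightarrow> (\<exists>i j. sdrop i x = sdrop j y)"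

lemma tail_eq_refl: "tail_eq x x"
  unfolding tail_eq_def by blast

lemma tail_eq_sdrop: "tail_eq x (sdrop m x)"
  unfolding tail_eq_def by (rule exI[of _ m], rule exI[of _ 0]) simp

lemma tail_eq_trans:
  assumes "tail_eq x y" "tail_eq y z"
  shows "tail_eq x z"
proof -
  obtain i j k l where "sdrop i x = sdrop j y" "sdrop k y = sdrop l z"
    using assms unfolding tail_eq_def by blast
  then have "sdrop (k + i) x = sdrop (j + l) z"
    by (metis add.commute sdrop_add)
  then show ?thesis unfolding tail_eq_def by blast
qed

lemma tail_eq_psi: "tail_eq x y \<Longrightarrow> tail_eq (psi a x) (psi a y)"
  unfolding tail_eq_def by (metis psi_sdrop)

lemma tail_eq_psi_pow: "tail_eq x y \<Longrightarrow> tail_eq ((psi a ^^ n) x) ((psi a ^^ n) y)"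
  by (induction n) (simp_all add: tail_eq_psi)

lemma tail_eq_sigma: "tail_eq x y \<Longrightarrow> tail_eq (sigma a x) (sigma a y)"
  unfolding tail_eq_def by (metis sigma_sdrop)

lemma sdrop_mult_period: "sdrop p x = x \<Longrightarrow> sdrop (p * n) x = x"
  by (induction n) (simp_all add: sdrop_add[symmetric])

text \<open>Every prefix of \<open>w\<close> recurs inside the periodic tail; one residue of its position modulo the
  period serves infinitely many, hence all, prefixes.\<close>

lemma recurrent_tail_eq_periodic_imp_shift:
  assumes rec: "recurrent_word w" and per: "periodic_word P" and te: "tail_eq w P"
  shows "shift_of w P"
proof -
  obtain p where p: "p > 0" "sdrop p P = P" using per unfolding periodic_word_def by blast
  obtain i j where ij: "sdrop i w = sdrop j P" using te unfolding tail_eq_def by blast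
  have "\<exists>r<p. stake n w = stake n (sdrop r P)" for n
  proof -
    have "factor_of (stake n w) w" unfolding factor_of_def by (rule exI[of _ 0]) simp
    then have "infinite {i. stake n (sdrop i w) = stake n w}"
      using rec unfolding recurrent_word_def by fastforce
    then obtain i' where i': "i' \<ge> i" "stake n (sdrop i' w) = stake n w"
      by (metis (mono_tags, lifting) mem_Collect_eq infinite_nat_iff_unbounded_le)
    have "sdrop i' w = sdrop (i' - i) (sdrop i w)" using i' by (simp add: sdrop_add)
    also have "\<dots> = sdrop (j + (i' - i)) P" by (simp add: ij sdrop_add)
    also have "\<dots> = sdrop ((j + (i' - i)) mod p) (sdrop (p * ((j + (i' - i)) div p)) P)"
      by (simp add: sdrop_add)
    also have "\<dots> = sdrop ((j + (i' - i)) mod p) P" by (simp add: sdrop_mult_period p)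
    finally show ?thesis using i' p by (metis mod_less_divisor)
  qed
  then obtain r where r: "\<And>n. r n < p" "\<And>n. stake n w = stake n (sdrop (r n) P)" by metis
  have "finite (range r)" using r(1) by (meson finite_lessThan finite_subset image_subsetI lessThan_iff)
  then obtain s where s: "infinite {n. r n = s}"
    using inf_img_fin_domE[of r UNIV] by (auto simp: vimage_def)
  have "w !! m = sdrop s P !! m" for m
  proof -
    obtain n where n: "n > m" "r n = s" using s by (metis (mono_tags, lifting) mem_Collect_eq infinite_nat_iff_unbounded)
    then show ?thesis using r(2)[of n] by (metis stake_nth)
  qed
  then have "w = sdrop s P" by (rule stream_eq_snthI)
  then show ?thesis unfolding shift_of_def by blast
qed

subsection \<open>Words as functions on positions\<close>

definition cnt :: "(nat \<Rightarrow> 'a) \<Rightarrow> 'a \<Rightarrow> nat \<Rightarrow> nat \<Rightarrow> nat" where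
  "cnt f x i j = count_list (map f [i..<j]) x"

text \<open>One inequality suffices, because \<open>i\<close> and \<open>j\<close> can be
  exchanged.\<close>

definition balanced_fun :: "(nat \<Rightarrow> 'a) \<Rightarrow> bool" where
  "balanced_fun f \<longleftrightarrow> (\<forall>x i j N. cnt f x i (i + N) \<le> cnt f x j (j + N) + 1)"

definition return_at :: "(nat \<Rightarrow> 'a) \<Rightarrow> 'a \<Rightarrow> nat \<Rightarrow> nat \<Rightarrow> bool" where
  "return_at f x i j \<longleftrightarrow> i < j \<and> f i = x \<and> f j = x \<and> (\<forall>t. i < t \<and> t < j \<longrightarrow> f t \<noteq> x)"

definition rich_fun :: "(nat \<Rightarrow> 'a) \<Rightarrow> bool" where
  "rich_fun f \<longleftrightarrow> (\<forall>x i j. return_at f x i j \<longrightarrow> rev (map f [i..<Suc j]) = map f [i..<Suc j])"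

text \<open>Recurrence restricted to single letters, a form that passes directly to tails and to
  deletions.\<close>

definition letters_recur :: "(nat \<Rightarrow> 'a) \<Rightarrow> bool" where
  "letters_recur f \<longleftrightarrow> (\<forall>i m. \<exists>j\<ge>m. f j = f i)"

definition good :: "(nat \<Rightarrow> 'a) \<Rightarrow> bool" where
  "good f \<longleftrightarrow> letters_recur f \<and> balanced_fun f \<and> rich_fun f"

definition squarefree_letters :: "(nat \<Rightarrow> 'a) \<Rightarrow> bool" where
  "squarefree_letters f \<longleftrightarrow> (\<forall>i. f i \<noteq> f (Suc i))"

text \<open>The negation says that some tail satisfies \<open>squarefree_letters\<close>.\<close>

definition squares_recur :: "(nat \<Rightarrow> 'a) \<Rightarrow> bool" where
  "squares_recur f \<longleftrightarrow> (\<forall>m. \<exists>i\<ge>m. f i = f (Suc i))"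

definition constant_fun :: "(nat \<Rightarrow> 'a) \<Rightarrow> bool" where
  "constant_fun f \<longleftrightarrow> (\<forall>i. f i = f 0)"

definition tl_fun :: "nat \<Rightarrow> (nat \<Rightarrow> 'a) \<Rightarrow> nat \<Rightarrow> 'a" where
  "tl_fun m f = (\<lambda>i. f (m + i))"

lemma map_tl_fun: "map (tl_fun m f) [i..<j] = map f [m + i..<m + j]"
  by (rule nth_equalityI) (auto simp: tl_fun_def add.assoc)

lemma cnt_tl_fun: "cnt (tl_fun m f) x i j = cnt f x (m + i) (m + j)"
  by (simp add: cnt_def map_tl_fun)

lemma balanced_tl_fun: "balanced_fun f \<Longrightarrow> balanced_fun (tl_fun m f)"
  unfolding balanced_fun_def cnt_tl_fun by (metis add.assoc)

lemma return_at_tl_fun: "return_at (tl_fun m f) x i j \<Longrightarrow> return_at f x (m + i) (m + j)"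
proof -
  assume r: "return_at (tl_fun m f) x i j"
  have "f t \<noteq> x" if t: "m + i < t" "t < m + j" for t
  proof -
    have "i < t - m" "t - m < j" using t by linarith+
    then have "tl_fun m f (t - m) \<noteq> x" using r unfolding return_at_def by blast
    then show ?thesis using t by (simp add: tl_fun_def)
  qed
  then show ?thesis using r by (simp add: return_at_def tl_fun_def)
qed

lemma rich_tl_fun: "rich_fun f \<Longrightarrow> rich_fun (tl_fun m f)"
  unfolding rich_fun_def map_tl_fun using return_at_tl_fun by fastforce

lemma letters_recur_tl_fun: "letters_recur f \<Longrightarrow> letters_recur (tl_fun m f)"
  unfolding letters_recur_def tl_fun_def
  by (metis add_le_cancel_left le_Suc_ex le_add1 le_trans)

lemma good_tl_fun: "good f \<Longrightarrow> good (tl_fun m f)"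
  by (simp add: good_def balanced_tl_fun rich_tl_fun letters_recur_tl_fun)

lemma range_tl_fun:
  assumes "letters_recur f"
  shows "range (tl_fun m f) = range f"
proof
  show "range f \<subseteq> range (tl_fun m f)"
  proof
    fix x assume "x \<in> range f"
    then obtain j where "j \<ge> m" "f j = x" using assms unfolding letters_recur_def by blast
    then have "tl_fun m f (j - m) = x" by (simp add: tl_fun_def)
    then show "x \<in> range (tl_fun m f)" by blast
  qed
qed (auto simp: tl_fun_def)

lemma constant_iff_range: "constant_fun f \<longleftrightarrow> (\<exists>c. range f = {c})"
proof
  assume "constant_fun f"
  then have "range f = {f 0}" by (auto simp: constant_fun_def)
  then show "\<exists>c. range f = {c}" by blast
next
  assume "\<exists>c. range f = {c}"
  then show "constant_fun f" unfolding constant_fun_def by (metis rangeI singletonD)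
qed

lemma constant_tl_fun: "letters_recur f \<Longrightarrow> constant_fun (tl_fun m f) \<longleftrightarrow> constant_fun f"
  by (simp add: constant_iff_range range_tl_fun)

lemma squares_recur_tl_fun: "squares_recur f \<Longrightarrow> squares_recur (tl_fun m f)"
  unfolding squares_recur_def tl_fun_def
  by (metis add_Suc_right add_le_cancel_left le_Suc_ex le_add1 le_trans)

lemma squarefree_tl_fun: "squarefree_letters f \<Longrightarrow> squarefree_letters (tl_fun m f)"
  unfolding squarefree_letters_def tl_fun_def by simp

lemma upt_split: "i \<le> j \<Longrightarrow> j \<le> k \<Longrightarrow> [i..<k] = [i..<j] @ [j..<k]"
  using upt_add_eq_append[of i j "k - j"] by simp

section \<open>Letter counts in windows and lengths of returns\<close>

lemma cnt_mono:
  assumes "k \<le> i" "j \<le> l"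
  shows "cnt f x i j \<le> cnt f x k l"
proof (cases "i \<le> j")
  case True
  then have "[k..<l] = [k..<i] @ [i..<j] @ [j..<l]"
    using assms by (metis le_trans upt_split)
  then show ?thesis by (simp add: cnt_def)
qed (simp add: cnt_def)

text \<open>Truncating the longer window to the length of the shorter one can only lower its
  count.\<close>

lemma balanced_cnt_le:
  assumes "balanced_fun f" "i \<le> j" "j - i \<le> l - k"
  shows "cnt f x i j \<le> cnt f x k l + 1"
proof (cases "k \<le> l")
  case True
  have "cnt f x i (i + (j - i)) \<le> cnt f x k (k + (j - i)) + 1"
    using assms(1) unfolding balanced_fun_def by blast
  also have "cnt f x k (k + (j - i)) \<le> cnt f x k l"
    using assms True by (intro cnt_mono) auto
  finally show ?thesis using assms by simp
qed (use assms in \<open>simp add: cnt_def\<close>)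

lemma cnt_eq_0: "(\<And>t. i \<le> t \<Longrightarrow> t < j \<Longrightarrow> f t \<noteq> x) \<Longrightarrow> cnt f x i j = 0"
  unfolding cnt_def by (force simp: count_list_0_iff)

lemma cnt_split: "i \<le> j \<Longrightarrow> j \<le> k \<Longrightarrow> cnt f x i k = cnt f x i j + cnt f x j k"
  unfolding cnt_def by (metis count_list_append map_append upt_split)

lemma cnt_Suc: "i \<le> j \<Longrightarrow> cnt f x i (Suc j) = cnt f x i j + (if f j = x then 1 else 0)"
  by (simp add: cnt_def)

lemma return_cnt:
  assumes "return_at f x i j"
  shows "cnt f x i (Suc j) = 2" "cnt f x (Suc i) j = 0"
proof -
  show 0: "cnt f x (Suc i) j = 0" using assms by (intro cnt_eq_0) (auto simp: return_at_def)
  have "cnt f x i (Suc i) = 1" using assms by (simp add: return_at_def cnt_def)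
  moreover have "cnt f x i (Suc j) = cnt f x i (Suc i) + cnt f x (Suc i) (Suc j)"
    using assms by (intro cnt_split) (auto simp: return_at_def)
  ultimately show "cnt f x i (Suc j) = 2"
    using assms 0 by (simp add: cnt_Suc return_at_def)
qed

text \<open>Otherwise the interior of the second return, free of \<open>x\<close>, would be at least
  as long as the whole first return, which contains \<open>x\<close> twice.\<close>

lemma return_gap_le:
  assumes "balanced_fun f" "return_at f x i j" "return_at f x k l"
  shows "l - k \<le> Suc (j - i)"
proof (rule ccontr)
  assume "\<not> ?thesis"
  then have "Suc j - i \<le> l - Suc k" using assms(2) by (auto simp: return_at_def)
  then have "cnt f x i (Suc j) \<le> cnt f x (Suc k) l + 1"
    using assms by (intro balanced_cnt_le) (auto simp: return_at_def)
  then show False using return_cnt assms by (metis One_nat_def add_0 not_less_eq_eq numeral_2_eq_2 le_refl)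
qed

lemma rich_sym:
  assumes "rich_fun f" "return_at f x i j" "t \<le> j - i"
  shows "f (i + t) = f (j - t)"
proof -
  have ij: "i < j" using assms by (simp add: return_at_def)
  have "map f [i..<Suc j] ! t = rev (map f [i..<Suc j]) ! t"
    using assms unfolding rich_fun_def by metis
  also have "\<dots> = map f [i..<Suc j] ! (j - i - t)"
    using ij assms by (subst rev_nth) (auto simp del: upt_Suc)
  finally show ?thesis using ij assms by (simp del: upt_Suc add: nth_map)
qed

lemma next_return_exists:
  assumes "letters_recur f"
  shows "\<exists>j. return_at f (f i) i j"
proof -
  have ex: "\<exists>j. i < j \<and> f j = f i" using assms unfolding letters_recur_def by (meson Suc_le_eq)
  define j where "j = (LEAST j. i < j \<and> f j = f i)"
  have "i < j \<and> f j = f i" unfolding j_def using ex by (rule LeastI_ex)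
  moreover have "\<forall>t. i < t \<and> t < j \<longrightarrow> f t \<noteq> f i" unfolding j_def using not_less_Least by blast
  ultimately show ?thesis unfolding return_at_def by blast
qed

text \<open>If every return to \<open>c\<close> had distance 1, then \<open>c\<close> would fill a
  whole tail, and recurrence would make \<open>f\<close> constant.\<close>

lemma long_return_exists:
  assumes "letters_recur f" "\<not> constant_fun f" "c \<in> range f"
  shows "\<exists>i j. return_at f c i j \<and> i + 2 \<le> j"
proof (rule ccontr)
  assume no: "\<not> ?thesis"
  obtain i0 where i0: "f i0 = c" using assms by blast
  have step: "f i = c \<Longrightarrow> f (Suc i) = c" for i
    using next_return_exists[OF assms(1), of i] no unfolding return_at_def
    by (metis Suc_leI add_2_eq_Suc' le_antisym not_less_eq_eq)
  have "f i = c" if "i \<ge> i0" for i using that by (induction rule: dec_induct) (auto simp: i0 step)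
  then have "f i = c" for i using assms(1) unfolding letters_recur_def by metis
  then show False using assms(2) by (simp add: constant_fun_def)
qed

text \<open>By induction, a letter other than \<open>a\<close> is preceded by an \<open>a\<close>;
  the return starting at that \<open>a\<close> is not of distance 1, so it ends two positions later.
  This yields separating letters both in a word and in its deletion.\<close>

lemma short_returns_separate:
  assumes rec: "letters_recur f" and m: "f m = a" and i: "m \<le> i" "f i \<noteq> a"
    and short: "\<And>k l. m \<le> k \<Longrightarrow> return_at f a k l \<Longrightarrow> l - k \<le> 2"
  shows "f (Suc i) = a"
  using i
proof (induction i rule: dec_induct)
  case base
  then show ?case using m by simp
next
  case (step i)
  then have fi: "f i = a" by blast
  obtain l where l: "return_at f a i l" using next_return_exists[OF rec, of i] fi by blast
  then have "l - i \<le> 2" "l \<noteq> Suc i" "i < l" using short step by (auto simp: return_at_def)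
  then have "l = Suc (Suc i)" by simp
  then show ?case using l by (simp add: return_at_def)
qed

text \<open>An odd distance gives a palindrome of even length, whose two central letters form a
  square.\<close>

lemma squarefree_return_even:
  assumes "rich_fun f" "squarefree_letters f" "return_at f x i j"
  shows "even (j - i)"
proof (rule ccontr)
  assume "odd (j - i)"
  then obtain t where t: "j - i = 2 * t + 1" by (elim oddE)
  then have "f (i + t) = f (j - t)" using rich_sym[OF assms(1,3), of t] by simp
  moreover have "j - t = Suc (i + t)" using t by simp
  ultimately show False using assms(2) unfolding squarefree_letters_def by metis
qed

text \<open>Two even distances that differ by at most one are equal.\<close>

lemma squarefree_return_const:
  assumes "good f" "squarefree_letters f" "return_at f x i j" "return_at f x k l"
  shows "j - i = l - k"
proof -
  have "even (j - i)" "even (l - k)"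
    using squarefree_return_even assms unfolding good_def by metis+
  moreover have "l - k \<le> Suc (j - i)" "j - i \<le> Suc (l - k)"
    using return_gap_le assms unfolding good_def by metis+
  ultimately show ?thesis by presburger
qed

lemma squarefree_gap2:
  assumes "good f" "squarefree_letters f"
  shows "\<exists>y i. return_at f y i (i + 2)"
proof -
  obtain j where j: "return_at f (f 0) 0 j" using next_return_exists assms unfolding good_def by blast
  then have "even j" "j > 0" using squarefree_return_even assms unfolding good_def
    by (fastforce simp: return_at_def)+
  then obtain s where s: "j = 2 * s" "s > 0" by (elim evenE) auto
  then obtain r where r: "s = Suc r" by (cases s) auto
  \<comment> \<open>\<open>r\<close> lies just before the centre \<open>s\<close> of the palindrome,
    so its mirror image lies just after it.\<close>
  have "f r = f (j - r)" using rich_sym[of f "f 0" 0 j r] assms j s r by (simp add: good_def)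
  moreover have "j - r = r + 2" using s r by simp
  ultimately have "return_at f (f r) r (r + 2)"
    using assms(2) unfolding return_at_def squarefree_letters_def
    by (metis Suc_leI add_2_eq_Suc' le_antisym less_Suc_eq_le less_add_same_cancel1 zero_less_numeral)
  then show ?thesis by blast
qed

subsection \<open>Deleting a separating letter\<close>

text \<open>The index that position \<open>i\<close> receives once \<open>a\<close> is
  deleted.\<close>

definition rank :: "(nat \<Rightarrow> 'a) \<Rightarrow> 'a \<Rightarrow> nat \<Rightarrow> nat" where
  "rank f a i = length (filter (\<lambda>x. x \<noteq> a) (map f [0..<i]))"

lemma rank_Suc: "rank f a (Suc i) = rank f a i + (if f i \<noteq> a then 1 else 0)"
  by (simp add: rank_def)

lemma rank_mono: "i \<le> j \<Longrightarrow> rank f a i \<le> rank f a j"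
  by (induction rule: dec_induct) (auto simp: rank_Suc)

lemma rank_const:
  assumes "i \<le> j" "\<And>t. i \<le> t \<Longrightarrow> t < j \<Longrightarrow> f t = a"
  shows "rank f a j = rank f a i"
  using assms by (induction rule: dec_induct) (auto simp: rank_Suc)

lemma cnt_rank: "i \<le> j \<Longrightarrow> cnt f a i j + rank f a j = (j - i) + rank f a i"
proof (induction rule: dec_induct)
  case base
  then show ?case by (simp add: cnt_def)
next
  case (step n)
  then show ?case by (simp add: cnt_Suc rank_Suc Suc_diff_le)
qed

text \<open>This is the balance of \<open>a\<close> read on the complementary letters: a window has
  at most one letter other than \<open>a\<close> more than any window at least as long. Sums replace
  differences to avoid truncated subtraction.\<close>

lemma balanced_rank:
  assumes "balanced_fun f" "k \<le> l" "i \<le> j" "l - k \<le> j - i"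
  shows "rank f a l + rank f a i \<le> rank f a j + rank f a k + 1"
proof -
  let ?j = "i + (l - k)"
  have "cnt f a i ?j \<le> cnt f a k l + 1" using assms by (intro balanced_cnt_le) auto
  moreover have "cnt f a i ?j + rank f a ?j = (l - k) + rank f a i" using cnt_rank[of i ?j] by simp
  moreover have "cnt f a k l + rank f a l = (l - k) + rank f a k" by (rule cnt_rank[OF assms(2)])
  moreover have "rank f a ?j \<le> rank f a j" using assms by (intro rank_mono) auto
  ultimately show ?thesis by linarith
qed

lemma count_list_filter: "P x \<Longrightarrow> count_list (filter P xs) x = count_list xs x"
  by (induction xs) auto

text \<open>\<open>p\<close> enumerates the positions of the letters other than \<open>a\<close>, so \<open>f \<circ> p\<close> is \<open>f\<close> with \<open>a\<close> deleted.\<close>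

locale deletion =
  fixes f :: "nat \<Rightarrow> 'a" and a :: 'a and p :: "nat \<Rightarrow> nat"
  assumes p_step: "p n + 2 \<le> p (Suc n)"
    and p_0: "0 < p 0"
    and p_range: "f i \<noteq> a \<longleftrightarrow> i \<in> range p"
begin

lemma p_mono: "strict_mono p"
  unfolding strict_mono_Suc_iff
proof
  fix n
  show "p n < p (Suc n)" using p_step[of n] by simp
qed

lemma p_less_iff: "p n < p m \<longleftrightarrow> n < m"
  using p_mono by (simp add: strict_mono_less)

lemma f_p: "f (p n) \<noteq> a"
  using p_range by blast

lemma f_between: "p n < t \<Longrightarrow> t < p (Suc n) \<Longrightarrow> f t = a"
  using p_range p_less_iff by (metis image_iff not_less_eq)

lemma f_before: "t < p 0 \<Longrightarrow> f t = a"
  using p_range p_less_iff by (metis image_iff not_less_zero)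

lemma f_pred: "f (p n - 1) = a"
proof (cases n)
  case 0
  then show ?thesis using p_0 by (intro f_before) auto
next
  case (Suc m)
  then show ?thesis using p_step[of m] by (intro f_between[of m]) auto
qed

lemma p_pos: "0 < p n"
  using p_0 p_less_iff by (metis gr_zeroI not_less0)

lemma rank_p: "rank f a (p n) = n"
proof (induction n)
  case 0
  have "rank f a (p 0) = rank f a 0" by (rule rank_const) (auto intro: f_before)
  then show ?case by (simp add: rank_def)
next
  case (Suc n)
  have "rank f a (p (Suc n)) = rank f a (Suc (p n))"
    using p_step[of n] by (intro rank_const) (auto intro: f_between[of n])
  then show ?case using Suc f_p by (simp add: rank_Suc)
qed

lemma rank_Suc_p: "rank f a (Suc (p n)) = Suc n"
  by (simp add: rank_Suc rank_p f_p)

lemma p_rank: "f i \<noteq> a \<Longrightarrow> p (rank f a i) = i"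
  using p_range rank_p by auto

text \<open>The bridge between the two words: letter counts and palindromes are both carried across
  the deletion through it.\<close>

lemma filter_window:
  "i \<le> j \<Longrightarrow> filter (\<lambda>x. x \<noteq> a) (map f [i..<j]) = map (f \<circ> p) [rank f a i..<rank f a j]"
proof (induction rule: dec_induct)
  case (step n)
  then show ?case using rank_mono[of i n f a] by (simp add: rank_Suc p_rank)
qed simp

lemma cnt_deletion:
  assumes "x \<noteq> a" "i \<le> j"
  shows "cnt f x i j = cnt (f \<circ> p) x (rank f a i) (rank f a j)"
  unfolding cnt_def filter_window[OF assms(2), symmetric]
  using assms by (simp add: count_list_filter)

lemma range_deletion: "range (f \<circ> p) = range f - {a}"
proof
  show "range (f \<circ> p) \<subseteq> range f - {a}" using f_p by auto
  show "range f - {a} \<subseteq> range (f \<circ> p)"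
  proof
    fix x assume "x \<in> range f - {a}"
    then obtain i where i: "x = f i" "f i \<noteq> a" by blast
    then show "x \<in> range (f \<circ> p)" using p_rank[of i] by (metis comp_apply rangeI)
  qed
qed

lemma letters_recur_deletion:
  assumes "letters_recur f"
  shows "letters_recur (f \<circ> p)"
  unfolding letters_recur_def
proof (intro allI)
  fix i m
  obtain j where j: "j \<ge> p m" "f j = f (p i)" using assms unfolding letters_recur_def by blast
  then have "p (rank f a j) = j" using f_p by (intro p_rank) simp
  moreover have "m \<le> rank f a j" using j(1) rank_mono rank_p by metis
  ultimately show "\<exists>j\<ge>m. (f \<circ> p) j = (f \<circ> p) i" using j by (metis comp_apply)
qed

lemma return_at_deletion:
  assumes "return_at (f \<circ> p) x n m"
  shows "return_at f x (p n) (p m)"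
proof -
  have "f t \<noteq> x" if t: "p n < t" "t < p m" for t
  proof
    assume "f t = x"
    then have "f t \<noteq> a" using assms f_p by (auto simp: return_at_def)
    then obtain k where "t = p k" using p_range by blast
    then show False using t \<open>f t = x\<close> assms by (auto simp: p_less_iff return_at_def)
  qed
  then show ?thesis using assms by (auto simp: return_at_def p_less_iff)
qed

text \<open>Filtering commutes with reversal, so a palindromic return stays a palindrome when
  \<open>a\<close> is removed from it.\<close>

lemma rich_deletion:
  assumes "rich_fun f"
  shows "rich_fun (f \<circ> p)"
  unfolding rich_fun_def
proof (intro allI impI)
  fix x n m
  assume r: "return_at (f \<circ> p) x n m"
  then have nm: "p n < p m" by (simp add: return_at_def p_less_iff)
  have "rev (map f [p n..<Suc (p m)]) = map f [p n..<Suc (p m)]"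
    using assms return_at_deletion[OF r] unfolding rich_fun_def by blast
  moreover have "map (f \<circ> p) [n..<Suc m] = filter (\<lambda>x. x \<noteq> a) (map f [p n..<Suc (p m)])"
    using nm by (subst filter_window) (auto simp: rank_p rank_Suc_p simp del: upt_Suc)
  ultimately show "rev (map (f \<circ> p) [n..<Suc m]) = map (f \<circ> p) [n..<Suc m]"
    by (metis rev_filter)
qed

text \<open>If two factors of \<open>f \<circ> p\<close> of equal length violate balance, compare their lifts to \<open>f\<close>. Either
  the lift with few \<open>x\<close>, extended by an \<open>a\<close> on both sides, is long enough to contradict the
  balance of \<open>x\<close>, or it is so short that the numbers of letters \<open>a\<close> are unbalanced.\<close>

lemma balanced_deletion:
  assumes bal: "balanced_fun f"
  shows "balanced_fun (f \<circ> p)"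
  unfolding balanced_fun_def
proof (intro allI, rule ccontr)
  fix x n m N
  let ?c = "cnt (f \<circ> p) x"
  assume "\<not> ?c n (n + N) \<le> ?c m (m + N) + 1"
  then have bad: "?c n (n + N) \<ge> ?c m (m + N) + 2" by simp
  have "?c n (n + N) \<le> N" using count_le_length[of "map (f \<circ> p) [n..<n + N]" x] by (simp add: cnt_def)
  \<comment> \<open>A surplus of two forces \<open>N \<ge> 2\<close>, so each window has distinct
    first and last indices.\<close>
  then obtain K where K: "N = Suc (Suc K)" using bad
    by (cases N rule: nat.exhaust; cases "N - 1") auto
  have x: "x \<noteq> a"
  proof
    assume "x = a"
    then have "?c n (n + N) = 0" using f_p by (intro cnt_eq_0) auto
    then show False using bad by simp
  qed
  let ?n = "n + Suc K" and ?m = "m + Suc K"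
  have n: "p n < p ?n" and m: "p m < p ?m" by (simp_all add: p_less_iff)
  have cn: "cnt f x (p n) (Suc (p ?n)) = ?c n (n + N)"
    using n x by (subst cnt_deletion) (auto simp: rank_p rank_Suc_p K)
  have "cnt f x (p m - 1) (Suc (Suc (p ?m))) = ?c m (m + N)"
  proof -
    have "f (Suc (p ?m)) = a" using p_step[of ?m] by (intro f_between[of ?m]) auto
    then have "rank f a (Suc (Suc (p ?m))) = m + N" by (simp add: rank_Suc_p rank_Suc[of _ _ "Suc _"] K)
    moreover have "rank f a (p m - 1) = m"
      using rank_Suc[of f a "p m - 1"] f_pred[of m] p_pos[of m] rank_p[of m] by simp
    ultimately show ?thesis using m x by (subst cnt_deletion) auto
  qed
  then have "\<not> Suc (p ?n) - p n \<le> Suc (Suc (p ?m)) - (p m - 1)"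
    using balanced_cnt_le[OF bal, of "p n" "Suc (p ?n)" "Suc (Suc (p ?m))" "p m - 1" x] n bad cn
    by linarith
  then have short: "p ?m + 3 - p m < Suc (p ?n) - p n" using p_pos[of m] m by linarith
  \<comment> \<open>The lift of the window at \<open>m\<close> contains \<open>N\<close> letters
    other than \<open>a\<close>; the interior of the lift at \<open>n\<close> is at least as long
    and contains only \<open>N - 2\<close>.\<close>
  have "rank f a (Suc (p ?m)) + rank f a (Suc (p n)) \<le> rank f a (p ?n) + rank f a (p m) + 1"
    using short n m by (intro balanced_rank[OF bal]) auto
  then show False by (simp add: rank_p rank_Suc_p)
qed

lemma good_deletion: "good f \<Longrightarrow> good (f \<circ> p)"
  by (simp add: good_def letters_recur_deletion rich_deletion balanced_deletion)

text \<open>The tail starts at \<open>p N - 1\<close>, where \<open>f\<close> has an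
  \<open>a\<close>, because \<open>p_0\<close> requires a deletion to begin with the deleted
  letter.\<close>

lemma deletion_tl: "deletion (tl_fun (p N - 1) f) a (\<lambda>n. p (N + n) - (p N - 1))"
proof
  have le: "p N \<le> p (N + n)" for n using p_mono by (simp add: strict_mono_less_eq)
  fix n i
  show "p (N + n) - (p N - 1) + 2 \<le> p (N + Suc n) - (p N - 1)"
    using p_step[of "N + n"] le[of n] by simp
  show "0 < p (N + 0) - (p N - 1)" using p_pos[of N] by simp
  show "(tl_fun (p N - 1) f i \<noteq> a) = (i \<in> range (\<lambda>n. p (N + n) - (p N - 1)))"
  proof
    assume "tl_fun (p N - 1) f i \<noteq> a"
    then have fa: "f (p N - 1 + i) \<noteq> a" by (simp add: tl_fun_def)
    then obtain k where k: "p N - 1 + i = p k" using p_range by blast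
    have "i \<noteq> 0" using fa f_pred[of N] by (metis add.right_neutral)
    then have "p N \<le> p k" using k by simp
    then have "N \<le> k" using p_mono by (simp add: strict_mono_less_eq)
    then have "i = p (N + (k - N)) - (p N - 1)" using k by simp
    then show "i \<in> range (\<lambda>n. p (N + n) - (p N - 1))" by blast
  next
    assume "i \<in> range (\<lambda>n. p (N + n) - (p N - 1))"
    then obtain n where "i = p (N + n) - (p N - 1)" by blast
    then have "p N - 1 + i = p (N + n)" using le[of n] by simp
    then show "tl_fun (p N - 1) f i \<noteq> a" by (simp add: tl_fun_def f_p)
  qed
qed

lemma tl_deletion: "tl_fun (p N - 1) f \<circ> (\<lambda>n. p (N + n) - (p N - 1)) = tl_fun N (f \<circ> p)"
proof
  fix n
  have "p N \<le> p (N + n)" using p_mono by (simp add: strict_mono_less_eq)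
  then show "(tl_fun (p N - 1) f \<circ> (\<lambda>n. p (N + n) - (p N - 1))) n = tl_fun N (f \<circ> p) n"
    by (simp add: tl_fun_def)
qed

end

lemma deletion_exists:
  assumes "f 0 = a" "\<And>i. f i \<noteq> a \<Longrightarrow> f (Suc i) = a" "letters_recur f" "\<not> constant_fun f"
  shows "\<exists>p. deletion f a p"
proof -
  let ?S = "{i. f i \<noteq> a}"
  obtain i where "f i \<noteq> a" using assms(1,4) by (auto simp: constant_fun_def)
  then have "\<forall>m. \<exists>n\<ge>m. n \<in> ?S"
    using assms(3) unfolding letters_recur_def mem_Collect_eq by metis
  then have inf: "infinite ?S" by (rule infinite_nat_iff_unbounded_le[THEN iffD2])
  have "deletion f a (enumerate ?S)"
  proof
    fix n
    have 1: "enumerate ?S n < enumerate ?S (Suc n)" using enumerate_step[OF inf] by blast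
    have "enumerate ?S n \<in> ?S" "enumerate ?S (Suc n) \<in> ?S" using enumerate_in_set[OF inf] by blast+
    then have "enumerate ?S (Suc n) \<noteq> Suc (enumerate ?S n)" using assms(2) by auto
    then show "enumerate ?S n + 2 \<le> enumerate ?S (Suc n)" using 1 by simp
  next
    have "enumerate ?S 0 \<in> ?S" using enumerate_in_set[OF inf] by blast
    then show "0 < enumerate ?S 0" using assms(1) by (auto intro: gr0I)
  next
    fix i
    show "(f i \<noteq> a) = (i \<in> range (enumerate ?S))" using range_enumerate[OF inf] by simp
  qed
  then show ?thesis by blast
qed

section \<open>From functions on positions back to streams\<close>

definition to_stream :: "(nat \<Rightarrow> 'a) \<Rightarrow> 'a stream" where
  "to_stream f = smap f nats"

lemma snth_to_stream [simp]: "to_stream f !! i = f i"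
  by (simp add: to_stream_def)

lemma sdrop_to_stream: "sdrop m (to_stream f) = to_stream (tl_fun m f)"
  by (rule stream_eq_snthI) (simp add: sdrop_snth tl_fun_def)

lemma shd_sdrop_to_stream: "shd (sdrop m (to_stream f)) = f m"
  by simp

lemma stl_sdrop: "stl (sdrop m x) = sdrop (Suc m) x"
  by simp

lemma sdrop_block:
  assumes "m \<le> n"
  shows "sdrop m (to_stream f) = map f [m..<n] @- sdrop n (to_stream f)"
proof (rule stream_eq_snthI)
  fix i
  show "sdrop m (to_stream f) !! i = (map f [m..<n] @- sdrop n (to_stream f)) !! i"
    using assms by (cases "i < n - m") (auto simp: sdrop_snth shift_snth_less shift_snth_ge add.commute)
qed

lemma tail_eq_tl_fun: "tail_eq (to_stream f) (to_stream (tl_fun m f))"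
  unfolding sdrop_to_stream[symmetric] by (rule tail_eq_sdrop)

lemma tail_eq_tl_fun': "tail_eq (to_stream (tl_fun m f)) (to_stream f)"
  using tail_eq_tl_fun unfolding tail_eq_def by metis

context deletion
begin

lemma map_run: "p (Suc n) = p n + Suc d \<Longrightarrow> map f [Suc (p n)..<p (Suc n)] = replicate d a"
  by (rule replicate_eqI) (auto intro: f_between[of n])

lemma tail_eq_psi_pow_deletion:
  assumes step: "\<And>n. n \<ge> N \<Longrightarrow> p (Suc n) = p n + Suc d"
  shows "tail_eq (to_stream f) ((psi a ^^ d) (to_stream (f \<circ> p)))"
proof -
  let ?g = "to_stream (f \<circ> p)"
  \<comment> \<open>Cutting just after a letter other than \<open>a\<close> makes each block a run
    of \<open>a\<close> followed by one letter, as in \<open>psi_pow_unfold\<close>.\<close>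
  let ?F = "\<lambda>n. sdrop (Suc (p (N + n))) (to_stream f)"
  let ?G = "\<lambda>n. (psi a ^^ d) (sdrop (Suc (N + n)) ?g)"
  let ?B = "\<lambda>n. replicate d a @ [f (p (Suc (N + n)))]"
  have "?F 0 = ?G 0"
  proof (rule stream_eq_blocksI[where F = ?F and G = ?G and B = ?B and nx = Suc])
    fix n
    have "?F n = map f [Suc (p (N + n))..<Suc (p (Suc (N + n)))] @- ?F (Suc n)"
      using step[of "N + n"] by (subst sdrop_block[of _ "Suc (p (Suc (N + n)))"]) auto
    then show "?F n = ?B n @- ?F (Suc n)"
      using step[of "N + n"] map_run[of "N + n" d] by (simp add: upt_Suc)
    show "?G n = ?B n @- ?G (Suc n)"
      using psi_pow_unfold[of "sdrop (Suc (N + n)) ?g" a d] f_p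
      unfolding shd_sdrop_to_stream stl_sdrop by (metis add_Suc_right comp_apply)
  qed simp
  then have "tail_eq (to_stream f) ((psi a ^^ d) (sdrop (Suc N) ?g))"
    using tail_eq_sdrop[of "to_stream f" "Suc (p N)"] by simp
  moreover have "tail_eq ((psi a ^^ d) (sdrop (Suc N) ?g)) ((psi a ^^ d) ?g)"
    unfolding sdrop_to_stream by (intro tail_eq_psi_pow tail_eq_tl_fun')
  ultimately show ?thesis by (rule tail_eq_trans)
qed

lemma tail_eq_sigma_deletion:
  assumes step: "\<And>n. n \<ge> N \<Longrightarrow> p (Suc n) = p n + (if f (p n) = f (p (Suc n)) then 3 else 2)"
  shows "tail_eq (to_stream f) (sigma a (to_stream (f \<circ> p)))"
proof -
  let ?g = "to_stream (f \<circ> p)"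
  \<comment> \<open>Cutting at the \<open>a\<close> just before a letter gives the blocks of
    \<open>sigma_unfold\<close>.\<close>
  let ?F = "\<lambda>n. sdrop (p (N + n) - 1) (to_stream f)"
  let ?G = "\<lambda>n. sigma a (sdrop (N + n) ?g)"
  let ?B = "\<lambda>n. if f (p (N + n)) = f (p (Suc (N + n)))
    then [a, f (p (N + n)), a] else [a, f (p (N + n))]"
  have "?F 0 = ?G 0"
  proof (rule stream_eq_blocksI[where F = ?F and G = ?G and B = ?B and nx = Suc])
    fix n
    define q where "q = p (N + n) - 1"
    have q: "p (N + n) = Suc q" using p_pos[of "N + n"] by (simp add: q_def)
    have fa: "f q = a" using f_pred[of "N + n"] by (simp add: q_def)
    have f2: "p (Suc (N + n)) = Suc q + 3 \<Longrightarrow> f (Suc (Suc q)) = a"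
      using q by (intro f_between[of "N + n"]) auto
    have "q \<le> p (Suc (N + n)) - 1" using p_step[of "N + n"] q by simp
    then have "?F n = map f [q..<p (Suc (N + n)) - 1] @- ?F (Suc n)"
      using sdrop_block[of q "p (Suc (N + n)) - 1" f] unfolding q_def add_Suc_right by blast
    moreover have "map f [q..<p (Suc (N + n)) - 1] = ?B n"
    proof (cases "f (p (N + n)) = f (p (Suc (N + n)))")
      case True
      then have "p (Suc (N + n)) = Suc (Suc (Suc (Suc q)))" using step[of "N + n"] q by simp
      then show ?thesis using True fa f2 q by simp
    next
      case False
      then have "p (Suc (N + n)) = Suc (Suc (Suc q))" using step[of "N + n"] q by simp
      then show ?thesis using False fa q by simp
    qed
    ultimately show "?F n = ?B n @- ?F (Suc n)" by simp
    show "?G n = ?B n @- ?G (Suc n)"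
      using sigma_unfold[of a "sdrop (N + n) ?g"]
      unfolding shd_sdrop_to_stream stl_sdrop comp_apply add_Suc_right .
  qed simp
  then have "tail_eq (to_stream f) (sigma a (sdrop N ?g))"
    using tail_eq_sdrop[of "to_stream f" "p N - 1"] by simp
  moreover have "tail_eq (sigma a (sdrop N ?g)) (sigma a ?g)"
    unfolding sdrop_to_stream by (intro tail_eq_sigma tail_eq_tl_fun')
  ultimately show ?thesis by (rule tail_eq_trans)
qed

end

subsection \<open>Words without squares of letters\<close>

lemma to_stream_constant: "constant_fun f \<Longrightarrow> to_stream f = sconst (f 0)"
  by (rule stream_eq_snthI) (simp add: constant_fun_def id_def[symmetric])

lemma squarefree_structure:
  assumes "finite (range f)" "good f" "squarefree_letters f \<or> constant_fun f"
  shows "\<exists>L c. distinct (L @ [c]) \<and> set (L @ [c]) = range f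
    \<and> tail_eq (to_stream f) (foldr psi L (sconst c))"
  using assms
proof (induction "card (range f)" arbitrary: f rule: less_induct)
  case less
  show ?case
  proof (cases "constant_fun f")
    case True
    then have "set ([] @ [f 0]) = range f" by (auto simp: constant_fun_def)
    then show ?thesis using tail_eq_refl to_stream_constant[OF True]
      by (intro exI[of _ "[]"] exI[of _ "f 0"]) auto
  next
    case False
    with less have sq: "squarefree_letters f" by simp
    have rec: "letters_recur f" using less by (simp add: good_def)
    obtain y m where ym: "return_at f y m (m + 2)" using squarefree_gap2 less sq by blast
    define h where "h = tl_fun m f"
    have h: "good h" "squarefree_letters h" "range h = range f"
      unfolding h_def using less sq rec by (simp_all add: good_tl_fun squarefree_tl_fun range_tl_fun)
    have h0: "return_at h y 0 2" using ym unfolding h_def return_at_def tl_fun_def by auto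
    \<comment> \<open>All returns to \<open>y\<close> have the same distance, hence 2, so
      \<open>y\<close> fills exactly the even positions.\<close>
    have step: "return_at h y i (i + 2)" if hi: "h i = y" for i
    proof -
      obtain j where j: "return_at h y i j"
        using next_return_exists[of h i] hi h(1) unfolding good_def by blast
      then have "j - i = 2" using squarefree_return_const[OF h(1,2) h0 j] by simp
      then show ?thesis using j by (metis add.commute le_add_diff_inverse less_imp_le return_at_def)
    qed
    have even: "h (2 * n) = y" for n
    proof (induction n)
      case 0
      then show ?case using h0 by (simp add: return_at_def)
    next
      case (Suc n)
      then show ?case using step[of "2 * n"] by (simp add: return_at_def)
    qed
    have odd: "h (2 * n + 1) \<noteq> y" for n
      using h(2) even[of n] unfolding squarefree_letters_def by (metis Suc_eq_plus1)
    let ?p = "\<lambda>n. 2 * n + 1"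
    interpret deletion h y ?p
    proof
      fix i
      show "(h i \<noteq> y) = (i \<in> range ?p)"
      proof (cases "even i")
        case True
        then have "h i = y" using even by (elim evenE) simp
        moreover have "i \<notin> range ?p" using True by auto
        ultimately show ?thesis by simp
      next
        case False
        then obtain n where n: "i = 2 * n + 1" by (elim oddE)
        then have "i \<in> range ?p" by (rule range_eqI)
        then show ?thesis using odd[of n] n by simp
      qed
    qed auto
    have y: "y \<in> range f" using even[of 0] h(3) by (metis rangeI)
    have card: "card (range (h \<circ> ?p)) < card (range f)"
      unfolding range_deletion h(3) using less(2) y by (intro psubset_card_mono) auto
    have fin: "finite (range (h \<circ> ?p))" unfolding range_deletion h(3) using less(2) by simp
    have sc: "squarefree_letters (h \<circ> ?p) \<or> constant_fun (h \<circ> ?p)"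
    proof (cases "squarefree_letters (h \<circ> ?p)")
      case False
      then obtain n where "h (2 * n + 1) = h (2 * Suc n + 1)" by (auto simp: squarefree_letters_def)
      then have n: "h (2 * n + 1) = h (2 * n + 3)" by (simp add: numeral_3_eq_3)
      let ?x = "h (2 * n + 1)"
      have "h (2 * n + 2) = y" using even[of "Suc n"] by simp
      \<comment> \<open>A square \<open>xx\<close> after deletion means that \<open>x\<close>
        returns at distance 2 in \<open>h\<close>. All its returns then have distance 2, so no
        return to \<open>x\<close> is long in the deleted word, which must be constant.\<close>
      then have r: "return_at h ?x (2 * n + 1) (2 * n + 3)"
        unfolding return_at_def using n odd[of n]
        by (auto simp: less_Suc_eq numeral_3_eq_3)
      have st: "h (2 * k + 3) = ?x" if hk: "h (2 * k + 1) = ?x" for k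
      proof -
        obtain j where j: "return_at h ?x (2 * k + 1) j"
          using next_return_exists[of h "2 * k + 1"] hk h(1) unfolding good_def by auto
        then have "j - (2 * k + 1) = 2" using squarefree_return_const[OF h(1,2) r j] by simp
        then have "j = 2 * k + 3" by simp
        then show ?thesis using j by (simp add: return_at_def)
      qed
      have "\<not> (\<exists>i j. return_at (h \<circ> ?p) ?x i j \<and> i + 2 \<le> j)"
      proof
        assume "\<exists>i j. return_at (h \<circ> ?p) ?x i j \<and> i + 2 \<le> j"
        then obtain i j where ij: "return_at (h \<circ> ?p) ?x i j" "i + 2 \<le> j" by blast
        then have "(h \<circ> ?p) i = ?x" "(h \<circ> ?p) (Suc i) \<noteq> ?x" by (auto simp: return_at_def)
        then show False using st[of i] by (simp add: numeral_3_eq_3)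
      qed
      then show ?thesis using long_return_exists[of "h \<circ> ?p" ?x] good_deletion[OF h(1)]
        by (metis comp_apply good_def rangeI)
    qed simp
    obtain L c where L: "distinct (L @ [c])" "set (L @ [c]) = range (h \<circ> ?p)"
        "tail_eq (to_stream (h \<circ> ?p)) (foldr psi L (sconst c))"
      using less(1)[OF card fin good_deletion[OF h(1)] sc] by blast
    have "tail_eq (to_stream h) ((psi y ^^ 1) (to_stream (h \<circ> ?p)))"
      by (rule tail_eq_psi_pow_deletion) simp
    then have "tail_eq (to_stream h) (psi y (foldr psi L (sconst c)))"
      using tail_eq_psi[OF L(3)] tail_eq_trans by fastforce
    then have "tail_eq (to_stream f) (foldr psi (y # L) (sconst c))"
      using tail_eq_tl_fun[of f m] tail_eq_trans unfolding h_def by fastforce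
    moreover have "distinct ((y # L) @ [c])" "set ((y # L) @ [c]) = range f"
      using L(1,2) y unfolding range_deletion h(3) by auto
    ultimately show ?thesis by blast
  qed
qed

subsection \<open>Words with infinitely many squares of letters\<close>

text \<open>The part of the balance of \<open>\<sigma>\<^sub>a(f)\<close> that is lost when \<open>a\<close> is deleted: neither \<open>bbb\<close> nor both
  of \<open>cbc\<close> and \<open>cbbc\<close> occur in \<open>f\<close>.\<close>

definition tame :: "(nat \<Rightarrow> 'a) \<Rightarrow> bool" where
  "tame f \<longleftrightarrow> (\<forall>i. \<not> (f i = f (i + 1) \<and> f i = f (i + 2))) \<and>
    (\<forall>i j. \<not> (f i \<noteq> f (i + 1) \<and> f (i + 2) = f i \<and> f j = f i \<and> f (j + 1) = f (i + 1)
      \<and> f (j + 2) = f (i + 1) \<and> f (j + 3) = f i))"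

lemma tame_tl_fun: "tame f \<Longrightarrow> tame (tl_fun m f)"
  unfolding tame_def tl_fun_def add.assoc[symmetric] by blast

text \<open>The second half mirrors the first, so every selected letter is counted twice.\<close>

lemma palindrome_even_filter:
  assumes "rev xs = xs" "even (length xs)"
  shows "even (length (filter P xs))"
proof -
  obtain h where h: "length xs = 2 * h" using assms(2) by (elim evenE)
  have "drop h xs = rev (take h xs)" using assms(1) h by (metis rev_take mult_2 add_diff_cancel_right')
  then have "filter P xs = filter P (take h xs) @ rev (filter P (take h xs))"
    by (metis append_take_drop_id filter_append rev_filter)
  then show ?thesis by simp
qed

context deletion
begin

lemma p_diff_ge:
  assumes "\<And>n. p n + c \<le> p (Suc n)" "k \<le> l"
  shows "p k + c * (l - k) \<le> p l"
  using assms(2)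
proof (induction rule: dec_induct)
  case (step n)
  then show ?case using assms(1)[of n] by (simp add: Suc_diff_le)
qed simp

text \<open>Otherwise the gap after \<open>p l\<close>, free of letters other than \<open>a\<close>,
  would be as long as a window holding two of them.\<close>

lemma run_le:
  assumes "balanced_fun f"
  shows "p (Suc l) - p l \<le> Suc (p (Suc k) - p k)"
proof (rule ccontr)
  assume "\<not> ?thesis"
  then have "rank f a (Suc (p (Suc k))) + rank f a (Suc (p l))
      \<le> rank f a (p (Suc l)) + rank f a (p k) + 1"
    using p_step[of k] p_step[of l] by (intro balanced_rank[OF assms]) auto
  then show False by (simp add: rank_p rank_Suc_p)
qed

text \<open>Let \<open>c\<close> be the distance in \<open>f\<close> between the two letters of the
  square. The lifted long return has distance at most \<open>c + 1\<close> and consists of at least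
  two gaps, each at least \<open>c - 1\<close> and at least 2. From
  \<open>2 * (c - 1) \<le> c + 1\<close> and \<open>4 \<le> c + 1\<close> it follows that
  \<open>c = 3\<close>, and then that there are exactly two gaps, both equal to 2.\<close>

lemma square_long_return:
  assumes bal: "balanced_fun f" and sq: "f (p n) = f (p (Suc n))"
    and ret: "return_at (f \<circ> p) (f (p n)) k l" "k + 2 \<le> l"
  shows "l = k + 2" "p (Suc n) = p n + 3" "p (Suc k) = p k + 2" "p (k + 2) = p (Suc k) + 2"
proof -
  define c where "c = p (Suc n) - p n"
  have c: "p (Suc n) = p n + c" "c \<ge> 2" using p_step[of n] by (simp_all add: c_def)
  have "return_at (f \<circ> p) (f (p n)) n (Suc n)" using sq by (auto simp: return_at_def)
  then have gap: "p l - p k \<le> Suc c"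
    using return_gap_le[OF bal return_at_deletion return_at_deletion[OF ret(1)]] c by fastforce
  have "p i + (c - 1) \<le> p (Suc i)" for i
    using run_le[OF bal, of n i] c p_step[of i] by simp
  then have 1: "p k + (c - 1) * (l - k) \<le> p l" using ret(2) by (intro p_diff_ge) auto
  have 2: "p k + 2 * (l - k) \<le> p l" using ret(2) p_step by (intro p_diff_ge) auto
  have "(c - 1) * 2 \<le> (c - 1) * (l - k)" using ret(2) by (intro mult_left_mono) auto
  then have "(c - 1) * 2 \<le> Suc c" using 1 gap by linarith
  then have c3: "c = 3" using 2 gap ret(2) c(2) by linarith
  then show l: "l = k + 2" using 2 gap ret(2) by linarith
  show "p (Suc n) = p n + 3" using c c3 by simp
  show "p (Suc k) = p k + 2" "p (k + 2) = p (Suc k) + 2"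
    using gap p_step[of k] p_step[of "Suc k"] unfolding l c3 by simp_all
qed

text \<open>From \<open>N\<close> on, the squared letter \<open>?b\<close> separates
  \<open>f \<circ> p\<close>, since its returns there have distance at most 2. Two different
  neighbours thus form one half of a return \<open>b x b\<close>, whose gaps are known; two equal
  neighbours form a square, whose gap is known as well.\<close>

lemma square_step:
  assumes good: "good f" and nc: "\<not> constant_fun (f \<circ> p)"
    and sq: "f (p N) = f (p (Suc N))" and n: "N \<le> n"
  shows "p (Suc n) = p n + (if f (p n) = f (p (Suc n)) then 3 else 2)"
proof -
  have bal: "balanced_fun f" and rec: "letters_recur (f \<circ> p)"
    using good letters_recur_deletion by (auto simp: good_def)
  let ?b = "f (p N)"
  have short: "l - k \<le> 2" if "return_at (f \<circ> p) ?b k l" for k l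
    using square_long_return(1)[OF bal sq that] by linarith
  show ?thesis
  proof (cases "f (p n) = f (p (Suc n))")
    case True
    obtain k l where "return_at (f \<circ> p) (f (p n)) k l" "k + 2 \<le> l"
      using long_return_exists[OF rec nc, of "f (p n)"] by auto
    then show ?thesis using square_long_return(2)[OF bal True] True by simp
  next
    case False
    show ?thesis
    proof (cases "f (p n) = ?b")
      case True
      then obtain l where l: "return_at (f \<circ> p) ?b n l" using next_return_exists[OF rec, of n] by auto
      moreover have "n < l" "l \<noteq> Suc n" using l False True by (auto simp: return_at_def)
      ultimately show ?thesis using square_long_return(3)[OF bal sq l] False by simp
    next
      case nb: False
      then have "N \<noteq> n" by auto
      then obtain m where m: "n = Suc m" "N \<le> m" using n by (cases n) auto
      \<comment> \<open>A letter other than \<open>?b\<close> is entered from a \<open>?b\<close>,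
        so the gap at \<open>n\<close> is the second half of the return starting at
        \<open>m\<close>.\<close>
      have "f (p m) = ?b"
        using short_returns_separate[OF rec, of N ?b m] m nb short by auto
      then obtain l where l: "return_at (f \<circ> p) ?b m l" using next_return_exists[OF rec, of m] by auto
      moreover have "m < l" "l \<noteq> Suc m" using l nb m by (auto simp: return_at_def)
      ultimately show ?thesis using square_long_return(4)[OF bal sq l] False m by simp
    qed
  qed
qed

lemma square_tame:
  assumes good: "good f" and nc: "\<not> constant_fun (f \<circ> p)" and sq: "f (p N) = f (p (Suc N))"
  shows "tame (tl_fun N (f \<circ> p))"
proof -
  note step = square_step[OF good nc sq]
  have bal: "balanced_fun f" and rec: "letters_recur (f \<circ> p)"
    using good letters_recur_deletion by (auto simp: good_def)
  \<comment> \<open>With \<open>b\<close> the repeated letter, \<open>bbb\<close> lifts to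
    \<open>baabaab\<close>. Its interior \<open>aabaa\<close> has one letter other than
    \<open>a\<close>, whereas a lifted return \<open>baxab\<close> of the same length has
    three.\<close>
  have no_cube: False if i: "N \<le> i" "f (p i) = f (p (Suc i))" "f (p i) = f (p (Suc (Suc i)))" for i
  proof -
    obtain k l where kl: "return_at (f \<circ> p) (f (p i)) k l" "k + 2 \<le> l"
      using long_return_exists[OF rec nc, of "f (p i)"] by auto
    have "p (k + 2) = p k + 4" using square_long_return[OF bal i(2) kl] by simp
    moreover have "p (Suc (Suc i)) = p i + 6" using step[of i] step[of "Suc i"] i by simp
    ultimately have "rank f a (Suc (p (k + 2))) + rank f a (Suc (p i))
        \<le> rank f a (p (Suc (Suc i))) + rank f a (p k) + 1"
      by (intro balanced_rank[OF bal]) auto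
    then show False by (simp only: rank_p rank_Suc_p)
  qed
  \<comment> \<open>The factors \<open>cbc\<close> and \<open>cbbc\<close> lift to returns to
    \<open>c\<close> of distances 4 and 7, which differ by more than one.\<close>
  have no_pair: False if h: "N \<le> i" "N \<le> j" "f (p i) \<noteq> f (p (Suc i))" "f (p (Suc (Suc i))) = f (p i)"
    "f (p j) = f (p i)" "f (p (Suc j)) = f (p (Suc i))" "f (p (Suc (Suc j))) = f (p (Suc i))"
    "f (p (Suc (Suc (Suc j)))) = f (p i)" for i j
  proof -
    have "return_at (f \<circ> p) (f (p i)) i (Suc (Suc i))"
      "return_at (f \<circ> p) (f (p i)) j (Suc (Suc (Suc j)))"
      using h by (auto simp: return_at_def less_Suc_eq)
    then have "p (Suc (Suc (Suc j))) - p j \<le> Suc (p (Suc (Suc i)) - p i)"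
      by (intro return_gap_le[OF bal] return_at_deletion)
    moreover have "p (Suc (Suc i)) = p i + 4" using step[of i] step[of "Suc i"] h by simp
    moreover have "p (Suc (Suc (Suc j))) = p j + 7"
      using step[of j] step[of "Suc j"] step[of "Suc (Suc j)"] h by simp
    ultimately show False by simp
  qed
  show ?thesis unfolding tame_def tl_fun_def
  proof (intro conjI allI notI, goal_cases)
    case (1 i)
    then show False using no_cube[of "N + i"] by fastforce
  next
    case (2 i j)
    then show False using no_pair[of "N + i" "N + j"] by (simp add: numeral_3_eq_3)
  qed
qed

text \<open>If \<open>y\<close> has a return \<open>y a\<^sup>e x a\<^sup>e y\<close>, parity makes all returns to \<open>y\<close> equally long, and the balance
  of \<open>a\<close> then forces the same shape on each of them.\<close>

lemma squarefree_run_const: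
  assumes good: "good f" and sf: "squarefree_letters (f \<circ> p)"
  shows "\<exists>N d. \<forall>n\<ge>N. p (Suc n) = p n + Suc d"
proof -
  have bal: "balanced_fun f" and rich: "rich_fun f" using good by (auto simp: good_def)
  have goodg: "good (f \<circ> p)" using good by (rule good_deletion)
  obtain y N where yN: "return_at (f \<circ> p) y N (N + 2)" using squarefree_gap2[OF goodg sf] by blast
  define e where "e = p (Suc N) - p N - 1"
  have e: "p (Suc N) = p N + Suc e" using p_step[of N] by (simp add: e_def)
  \<comment> \<open>The reflection of the lifted return sends its only inner letter other than
    \<open>a\<close> to such a letter, hence to itself.\<close>
  have mid: "p (Suc (Suc k)) - p (Suc k) = p (Suc k) - p k"
    if "return_at (f \<circ> p) y k (k + 2)" for k
  proof -
    have lt: "p k < p (Suc k)" "p (Suc k) < p (Suc (Suc k))" by (simp_all add: p_less_iff)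
    have "f (p k + (p (Suc k) - p k)) = f (p (k + 2) - (p (Suc k) - p k))"
      using lt by (intro rich_sym[OF rich return_at_deletion[OF that]]) auto
    then have "f (p (Suc (Suc k)) - (p (Suc k) - p k)) \<noteq> a" using lt f_p[of "Suc k"] by simp
    then obtain m where m: "p (Suc (Suc k)) - (p (Suc k) - p k) = p m" using p_range by blast
    then have "p k < p m" "p m < p (Suc (Suc k))" using lt by auto
    then have "m = Suc k" by (simp add: p_less_iff)
    then show ?thesis using m lt by simp
  qed
  \<comment> \<open>An odd distance makes the lifted return a palindrome of even length, in which
    the letters other than \<open>a\<close> are even in number. But they form a return in
    \<open>f \<circ> p\<close>, which has odd length.\<close>
  have even_gap: "even (p l - p k)" if r: "return_at (f \<circ> p) y k l" for k l
  proof (rule ccontr)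
    assume odd: "odd (p l - p k)"
    have kl: "k < l" "p k < p l" using r by (auto simp: return_at_def p_less_iff)
    have "rev (map f [p k..<Suc (p l)]) = map f [p k..<Suc (p l)]"
      using rich return_at_deletion[OF r] unfolding rich_fun_def by blast
    moreover have "even (length (map f [p k..<Suc (p l)]))"
      using odd kl by (simp add: Suc_diff_le del: upt_Suc)
    ultimately have "even (length (filter (\<lambda>x. x \<noteq> a) (map f [p k..<Suc (p l)])))"
      by (rule palindrome_even_filter)
    then have "even (Suc l - k)"
      using kl by (subst (asm) filter_window) (auto simp: rank_p rank_Suc_p simp del: upt_Suc)
    moreover have "even (l - k)"
      using squarefree_return_even[OF _ sf r] goodg by (simp add: good_def)
    ultimately show False using kl by (simp add: Suc_diff_le)
  qed
  have pN: "p (N + 2) = p N + 2 * Suc e" using mid[OF yN] e p_step[of "Suc N"] by simp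
  have same: "l = k + 2 \<and> p (Suc k) = p k + Suc e \<and> p (Suc (Suc k)) = p (Suc k) + Suc e"
    if r: "return_at (f \<circ> p) y k l" for k l
  proof -
    have kl: "k < l" "p k < p l" using r by (auto simp: return_at_def p_less_iff)
    have "p l - p k \<le> Suc (p (N + 2) - p N)" "p (N + 2) - p N \<le> Suc (p l - p k)"
      using return_gap_le[OF bal] return_at_deletion r yN by metis+
    then have gap: "p l - p k = p (N + 2) - p N"
      using even_gap[OF r] even_gap[OF yN] by presburger
    have ev: "even (l - k)" using squarefree_return_even[OF _ sf r] goodg by (simp add: good_def)
    \<comment> \<open>The two interiors are equally long and the one at \<open>N\<close> has a
      single letter other than \<open>a\<close>, so the other has at most two; parity leaves
      one.\<close>
    have "rank f a (p l) + rank f a (Suc (p N)) \<le> rank f a (p (N + 2)) + rank f a (Suc (p k)) + 1"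
      using gap kl pN by (intro balanced_rank[OF bal]) auto
    then have "l \<le> k + 3" by (simp only: rank_p rank_Suc_p)
    then have l: "l = k + 2" using ev kl by presburger
    then have "p (Suc (Suc k)) - p (Suc k) = p (Suc k) - p k" using mid r by simp
    moreover have "p (Suc (Suc k)) - p k = 2 * Suc e" using gap pN l by simp
    moreover define u where "u = p (Suc k) - p k"
    ultimately have "p (Suc k) = p k + u" "p (Suc (Suc k)) = p (Suc k) + u" "u = Suc e"
      using p_step[of k] p_step[of "Suc k"] by simp_all
    then show ?thesis using l by blast
  qed
  have recg: "letters_recur (f \<circ> p)" using goodg by (simp add: good_def)
  have y: "f (p (N + 2 * i)) = y" for i
  proof (induction i)
    case 0
    then show ?case using yN by (simp add: return_at_def)
  next
    case (Suc i)
    then obtain l where l: "return_at (f \<circ> p) y (N + 2 * i) l"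
      using next_return_exists[OF recg, of "N + 2 * i"] by auto
    then show ?case using same[OF l] by (simp add: return_at_def)
  qed
  have "p (Suc n) = p n + Suc e" if n: "N \<le> n" for n
  proof -
    define i where "i = (n - N) div 2"
    obtain l where l: "return_at (f \<circ> p) y (N + 2 * i) l"
      using next_return_exists[OF recg, of "N + 2 * i"] y[of i] by auto
    have "n = N + 2 * i \<or> n = Suc (N + 2 * i)" using n unfolding i_def by presburger
    then show ?thesis using same[OF l] by auto
  qed
  then show ?thesis by blast
qed

text \<open>Letters other than \<open>a\<close> are isolated, so a square in \<open>f\<close> is
  \<open>aa\<close> and lies strictly between two consecutive values of \<open>p\<close>.\<close>

lemma square_run:
  assumes "squares_recur f"
  shows "\<exists>n\<ge>N. p n + 3 \<le> p (Suc n)"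
proof -
  obtain i where i: "i \<ge> p N" "f i = f (Suc i)" using assms unfolding squares_recur_def by blast
  have "i < p (Suc i)" using p_mono by (metis Suc_le_eq strict_mono_imp_increasing)
  then have ex: "\<exists>m. i < p m" by blast
  define m where "m = (LEAST m. i < p m)"
  have im: "i < p m" unfolding m_def using ex by (rule LeastI_ex)
  then have "N < m" using i(1) p_less_iff by (meson le_less_trans)
  then obtain n where n: "m = Suc n" "N \<le> n" by (cases m) auto
  have "\<not> i < p n" using not_less_Least[of n "\<lambda>m. i < p m"] n unfolding m_def by simp
  moreover have "i \<noteq> p n"
  proof
    assume "i = p n"
    then have "f (Suc i) = a" using p_step[of n] by (intro f_between[of n]) auto
    then show False using i \<open>i = p n\<close> f_p by metis
  qed
  moreover have "Suc i \<noteq> p m" using i(2) f_p[of m] f_pred[of m] by (metis diff_Suc_1)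
  ultimately show ?thesis using im n by (intro exI[of _ n]) auto
qed

lemma tame_step_le:
  assumes "tame f"
  shows "p (Suc n) \<le> p n + 3"
proof (rule ccontr)
  assume "\<not> ?thesis"
  then have "f (p n + 1) = a" "f (p n + 1 + 1) = a" "f (p n + 1 + 2) = a"
    by (auto intro!: f_between[of n])
  then show False using assms[unfolded tame_def, THEN conjunct1, rule_format, of "p n + 1"] by simp
qed

text \<open>With \<open>c\<close> the only other letter, gaps 2 and 3 together would give both
  \<open>cac\<close> and \<open>caac\<close>, which \<open>tame\<close> excludes; a gap of 3 occurs
  because squares do.\<close>

lemma tame_binary_step:
  assumes t: "tame f" and sq: "squares_recur f" and c: "constant_fun (f \<circ> p)"
  shows "p (Suc n) = p n + 3"
proof (rule ccontr)
  assume "p (Suc n) \<noteq> p n + 3"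
  then have n: "p (Suc n) = p n + 2" using tame_step_le[OF t, of n] p_step[of n] by linarith
  obtain m where "p m + 3 \<le> p (Suc m)" using square_run[OF sq] by blast
  then have m: "p (Suc m) = p m + 3" using tame_step_le[OF t, of m] by linarith
  have g: "f (p i) = f (p 0)" for i using c by (simp add: constant_fun_def)
  have "f (p n + 1) = a" using n by (intro f_between[of n]) auto
  moreover have "f (p m + 1) = a" "f (p m + 2) = a" using m by (auto intro!: f_between[of m])
  moreover have "f (p n + 2) = f (p n)" "f (p m) = f (p n)" "f (p m + 3) = f (p n)"
    using g[of n] g[of m] g[of "Suc n"] g[of "Suc m"] n m by simp_all
  ultimately show False using t[unfolded tame_def, THEN conjunct2, rule_format, of "p n" "p m"] f_p[of n]
    by simp
qed

end

text \<open>One deletion step. If \<open>g\<close> is constant, the returns to its letter are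
  palindromes whatever the runs of \<open>a\<close>, so in that case the shape of \<open>f\<close>
  is asserted under \<open>tame\<close> only.\<close>

lemma squares_structure:
  assumes good: "good f" and sq: "squares_recur f" and nc: "\<not> constant_fun f"
  shows "\<exists>a g. a \<in> range f \<and> good g \<and> range g = range f - {a} \<and>
    ((tail_eq (to_stream f) (sigma a (to_stream g))
        \<and> squares_recur g \<and> \<not> constant_fun g \<and> tame g) \<or>
     (\<exists>d\<ge>2. (tame f \<longrightarrow> d = 2) \<and> tail_eq (to_stream f) ((psi a ^^ d) (to_stream g))
        \<and> squarefree_letters g) \<or>
     (constant_fun g \<and> (tame f \<longrightarrow> tail_eq (to_stream f) ((psi a ^^ 2) (to_stream g)))))"
proof -
  have rec: "letters_recur f" using good by (simp add: good_def)
  obtain m where m: "f m = f (Suc m)" using sq unfolding squares_recur_def by blast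
  define a where "a = f m"
  define h where "h = tl_fun m f"
  have h: "good h" "squares_recur h" "\<not> constant_fun h" "range h = range f"
    unfolding h_def using good sq nc rec
    by (simp_all add: good_tl_fun squares_recur_tl_fun constant_tl_fun range_tl_fun)
  have tame_h: "tame f \<Longrightarrow> tame h" unfolding h_def by (rule tame_tl_fun)
  have fh: "tail_eq (to_stream f) (to_stream h)" unfolding h_def by (rule tail_eq_tl_fun)
  have rech: "letters_recur h" and balh: "balanced_fun h" using h(1) by (simp_all add: good_def)
  have h0: "h 0 = a" "h (Suc 0) = a" using m by (simp_all add: h_def tl_fun_def a_def)
  then have r0: "return_at h a 0 (Suc 0)" by (auto simp: return_at_def)
  \<comment> \<open>The square \<open>aa\<close> is a return of distance 1, so every return to
    \<open>a\<close> has distance at most 2.\<close>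
  have "h (Suc i) = a" if "h i \<noteq> a" for i
  proof (rule short_returns_separate[OF rech h0(1) _ that])
    fix k l
    assume "return_at h a k l"
    from return_gap_le[OF balh r0 this] show "l - k \<le> 2" by simp
  qed simp
  then obtain p where "deletion h a p" using deletion_exists[OF h0(1) _ rech h(3)] by blast
  then interpret deletion h a p .
  have a: "a \<in> range f" unfolding a_def by blast
  have gg: "good (h \<circ> p)" using good_deletion[OF h(1)] .
  then have recg: "letters_recur (h \<circ> p)" by (simp add: good_def)
  have rg: "range (h \<circ> p) = range f - {a}" using range_deletion h(4) by simp
  consider (const) "constant_fun (h \<circ> p)"
    | (squares) "\<not> constant_fun (h \<circ> p)" "squares_recur (h \<circ> p)"
    | (free) N where "squarefree_letters (tl_fun N (h \<circ> p))"
    unfolding squares_recur_def squarefree_letters_def tl_fun_def by (metis add_Suc_right le_add1)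
  then show ?thesis
  proof cases
    case const
    have "tail_eq (to_stream f) ((psi a ^^ 2) (to_stream (h \<circ> p)))" if t: "tame f"
    proof -
      have "tail_eq (to_stream h) ((psi a ^^ 2) (to_stream (h \<circ> p)))"
        by (rule tail_eq_psi_pow_deletion[of 0])
          (simp add: tame_binary_step[OF tame_h[OF t] h(2) const])
      then show ?thesis using fh tail_eq_trans by blast
    qed
    then show ?thesis using a gg rg const by blast
  next
    case squares
    obtain N where N: "h (p N) = h (p (Suc N))"
      using squares(2) unfolding squares_recur_def by auto
    let ?g = "tl_fun N (h \<circ> p)"
    have "tail_eq (to_stream h) (sigma a (to_stream (h \<circ> p)))"
      by (rule tail_eq_sigma_deletion) (rule square_step[OF h(1) squares(1) N])
    moreover have "tail_eq (sigma a (to_stream (h \<circ> p))) (sigma a (to_stream ?g))"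
      by (intro tail_eq_sigma tail_eq_tl_fun)
    ultimately have "tail_eq (to_stream f) (sigma a (to_stream ?g))"
      using fh tail_eq_trans by blast
    moreover have "good ?g" "range ?g = range f - {a}" "squares_recur ?g" "\<not> constant_fun ?g"
      using gg rg recg squares
      by (simp_all add: good_tl_fun range_tl_fun squares_recur_tl_fun constant_tl_fun)
    moreover have "tame ?g" by (rule square_tame[OF h(1) squares(1) N])
    ultimately show ?thesis using a by blast
  next
    case free
    \<comment> \<open>\<open>squarefree_run_const\<close> needs the whole deleted word to be free of
      squares, so the deletion is restarted in a tail.\<close>
    let ?h = "tl_fun (p N - 1) h" and ?q = "\<lambda>n. p (N + n) - (p N - 1)"
    interpret q: deletion ?h a ?q by (rule deletion_tl)
    have hq: "?h \<circ> ?q = tl_fun N (h \<circ> p)" by (rule tl_deletion)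
    have goodh: "good ?h" using h(1) by (rule good_tl_fun)
    obtain M d where d: "\<And>n. n \<ge> M \<Longrightarrow> ?q (Suc n) = ?q n + Suc d"
      using q.squarefree_run_const[OF goodh] free unfolding hq by blast
    have te: "tail_eq (to_stream ?h) ((psi a ^^ d) (to_stream (tl_fun N (h \<circ> p))))"
      using q.tail_eq_psi_pow_deletion[OF d] unfolding hq .
    have "tail_eq (to_stream f) (to_stream ?h)"
      using fh tail_eq_tl_fun tail_eq_trans by blast
    then have te': "tail_eq (to_stream f) ((psi a ^^ d) (to_stream (tl_fun N (h \<circ> p))))"
      using te tail_eq_trans by blast
    obtain n where n: "n \<ge> M" "?q n + 3 \<le> ?q (Suc n)"
      using q.square_run[OF squares_recur_tl_fun[OF h(2)]] by blast
    have d2: "d \<ge> 2" using n(2) unfolding d[OF n(1)] by simp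
    have "d = 2" if "tame f"
      using q.tame_step_le[OF tame_tl_fun[OF tame_h[OF that]], of n] d2 unfolding d[OF n(1)] by simp
    moreover have "good (tl_fun N (h \<circ> p))" "range (tl_fun N (h \<circ> p)) = range f - {a}"
      using gg rg recg by (simp_all add: good_tl_fun range_tl_fun)
    ultimately show ?thesis using a te' d2 free by blast
  qed
qed

text \<open>Each deletion strips off one \<open>sigma\<close> and leaves a tame word, until the
  deleted word has no squares or is constant; \<open>tame\<close> then fixes the exponent 2.\<close>

lemma tame_structure:
  assumes "finite (range f)" "good f" "squares_recur f" "\<not> constant_fun f" "tame f"
  shows "\<exists>J b L c. distinct (J @ b # L @ [c]) \<and> set (J @ b # L @ [c]) = range f
    \<and> tail_eq (to_stream f) (foldr sigma J ((psi b ^^ 2) (foldr psi L (sconst c))))"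
  using assms
proof (induction "card (range f)" arbitrary: f rule: less_induct)
  case less
  obtain a g where a: "a \<in> range f" and g: "good g" "range g = range f - {a}"
    and cases: "(tail_eq (to_stream f) (sigma a (to_stream g))
        \<and> squares_recur g \<and> \<not> constant_fun g \<and> tame g) \<or>
     (squarefree_letters g \<or> constant_fun g)
        \<and> tail_eq (to_stream f) ((psi a ^^ 2) (to_stream g))"
    using squares_structure[OF less(3,4,5)] less(6) by blast
  have fin: "finite (range g)" using less(2) g by simp
  from cases show ?case
  proof
    assume s: "tail_eq (to_stream f) (sigma a (to_stream g))
        \<and> squares_recur g \<and> \<not> constant_fun g \<and> tame g"
    have "card (range g) < card (range f)"
      unfolding g(2) using less(2) a by (intro psubset_card_mono) auto
    then obtain J b L c where J: "distinct (J @ b # L @ [c])" "set (J @ b # L @ [c]) = range g"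
        "tail_eq (to_stream g) (foldr sigma J ((psi b ^^ 2) (foldr psi L (sconst c))))"
      using less(1)[OF _ fin g(1)] s by blast
    have "tail_eq (to_stream f) (foldr sigma (a # J) ((psi b ^^ 2) (foldr psi L (sconst c))))"
      using s tail_eq_sigma[OF J(3), of a] tail_eq_trans by fastforce
    moreover have "distinct ((a # J) @ b # L @ [c])" "set ((a # J) @ b # L @ [c]) = range f"
      using J(1,2) g(2) a by auto
    ultimately show ?thesis by blast
  next
    assume s: "(squarefree_letters g \<or> constant_fun g)
        \<and> tail_eq (to_stream f) ((psi a ^^ 2) (to_stream g))"
    obtain L c where L: "distinct (L @ [c])" "set (L @ [c]) = range g"
        "tail_eq (to_stream g) (foldr psi L (sconst c))"
      using squarefree_structure[OF fin g(1)] s by blast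
    have "tail_eq (to_stream f) (foldr sigma [] ((psi a ^^ 2) (foldr psi L (sconst c))))"
      using s tail_eq_psi_pow[OF L(3), of 2 a] tail_eq_trans by fastforce
    moreover have "distinct ([] @ a # L @ [c])" "set ([] @ a # L @ [c]) = range f"
      using L(1,2) g(2) a by auto
    ultimately show ?thesis by blast
  qed
qed

text \<open>The first deletion is done without \<open>tame\<close>, which leaves the exponent in the
  first family free. Once one \<open>sigma\<close> has been split off, the rest is tame.\<close>

lemma good_structure:
  assumes fin: "finite (range f)" and good: "good f" and card: "card (range f) \<ge> 3"
  shows "(\<exists>n a L c. n \<ge> 1 \<and> distinct (a # L @ [c]) \<and> set (a # L @ [c]) = range f
      \<and> tail_eq (to_stream f) ((psi a ^^ n) (foldr psi L (sconst c)))) \<or>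
    (\<exists>J b L c. J \<noteq> [] \<and> distinct (J @ b # L @ [c]) \<and> set (J @ b # L @ [c]) = range f
      \<and> tail_eq (to_stream f) (foldr sigma J ((psi b ^^ 2) (foldr psi L (sconst c)))))"
proof (cases "squares_recur f")
  case False
  have rec: "letters_recur f" using good by (simp add: good_def)
  obtain N where "squarefree_letters (tl_fun N f)" using False
    unfolding squares_recur_def squarefree_letters_def tl_fun_def by (metis add_Suc_right le_add1)
  then obtain L c where L: "distinct (L @ [c])" "set (L @ [c]) = range f"
      "tail_eq (to_stream (tl_fun N f)) (foldr psi L (sconst c))"
    using squarefree_structure[of "tl_fun N f"] fin good_tl_fun[OF good] range_tl_fun[OF rec] by metis
  have te: "tail_eq (to_stream f) (foldr psi L (sconst c))"
    using L(3) tail_eq_tl_fun tail_eq_trans by blast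
  have "L \<noteq> []" using L(2) card by (auto simp flip: L(2))
  then obtain a L' where "L = a # L'" by (cases L) auto
  \<comment> \<open>Without squares the outermost map is read as a power with exponent 1.\<close>
  then show ?thesis using L te by (intro disjI1 exI[of _ 1] exI[of _ a] exI[of _ L'] exI[of _ c]) auto
next
  case True
  have nc: "\<not> constant_fun f" using card unfolding constant_iff_range by auto
  obtain a g where a: "a \<in> range f" and g: "good g" "range g = range f - {a}"
    and cases: "(tail_eq (to_stream f) (sigma a (to_stream g))
        \<and> squares_recur g \<and> \<not> constant_fun g \<and> tame g) \<or>
     (\<exists>d\<ge>2. tail_eq (to_stream f) ((psi a ^^ d) (to_stream g)) \<and> squarefree_letters g) \<or>
     constant_fun g"
    using squares_structure[OF good True nc] by blast
  have fing: "finite (range g)" using fin g by simp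
  \<comment> \<open>Three letters in \<open>f\<close> leave two in \<open>g\<close>, which rules out
    the constant case.\<close>
  have "card (range g) \<ge> 2" using card a fin unfolding g(2) by simp
  then have "\<not> constant_fun g" unfolding constant_iff_range by auto
  with cases consider (sigma) "tail_eq (to_stream f) (sigma a (to_stream g))"
        "squares_recur g" "\<not> constant_fun g" "tame g"
    | (psi) d where "d \<ge> 2" "tail_eq (to_stream f) ((psi a ^^ d) (to_stream g))"
        "squarefree_letters g" by blast
  then show ?thesis
  proof cases
    case sigma
    obtain J b L c where J: "distinct (J @ b # L @ [c])" "set (J @ b # L @ [c]) = range g"
        "tail_eq (to_stream g) (foldr sigma J ((psi b ^^ 2) (foldr psi L (sconst c))))"
      using tame_structure[OF fing g(1) sigma(2-4)] by blast
    have "tail_eq (to_stream f) (foldr sigma (a # J) ((psi b ^^ 2) (foldr psi L (sconst c))))"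
      using sigma(1) tail_eq_sigma[OF J(3), of a] tail_eq_trans by fastforce
    moreover have "distinct ((a # J) @ b # L @ [c])" "set ((a # J) @ b # L @ [c]) = range f"
      using J(1,2) g(2) a by auto
    ultimately show ?thesis by blast
  next
    case psi
    obtain L c where L: "distinct (L @ [c])" "set (L @ [c]) = range g"
        "tail_eq (to_stream g) (foldr psi L (sconst c))"
      using squarefree_structure[OF fing g(1)] psi by blast
    have "tail_eq (to_stream f) ((psi a ^^ d) (foldr psi L (sconst c)))"
      using psi tail_eq_psi_pow[OF L(3), of d a] tail_eq_trans by blast
    moreover have "distinct (a # L @ [c])" "set (a # L @ [c]) = range f"
      using L(1,2) g(2) a by auto
    moreover have "1 \<le> d" using psi by simp
    ultimately show ?thesis by blast
  qed
qed

subsection \<open>The classification\<close>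

lemma stake_sdrop_conv_map: "stake N (sdrop i w) = map ((!!) w) [i..<i + N]"
  by (rule nth_equalityI) (auto simp: sdrop_snth)

lemma factor_of_window: "factor_of (map ((!!) w) [i..<j]) w"
  unfolding factor_of_def
proof (cases "i \<le> j")
  case True
  then show "\<exists>k. stake (length (map ((!!) w) [i..<j])) (sdrop k w) = map ((!!) w) [i..<j]"
    by (intro exI[of _ i]) (simp add: stake_sdrop_conv_map)
qed simp

lemma good_snth:
  assumes "recurrent_word w" "balanced_word w" "weakly_rich w"
  shows "good ((!!) w)"
  unfolding good_def
proof (intro conjI)
  show "letters_recur ((!!) w)"
    unfolding letters_recur_def
  proof (intro allI)
    fix i m
    have "factor_of [w !! i] w" using factor_of_window[of w i "Suc i"] by simp
    then have "infinite {j. stake 1 (sdrop j w) = [w !! i]}"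
      using assms(1) unfolding recurrent_word_def by fastforce
    then obtain j where "j \<ge> m" "stake 1 (sdrop j w) = [w !! i]"
      unfolding infinite_nat_iff_unbounded_le by blast
    then show "\<exists>j\<ge>m. w !! j = w !! i" by auto
  qed
  show "balanced_fun ((!!) w)"
    unfolding balanced_fun_def cnt_def
  proof (intro allI)
    fix x i j N
    have "\<bar>int (count_list (map ((!!) w) [i..<i + N]) x)
        - int (count_list (map ((!!) w) [j..<j + N]) x)\<bar> \<le> 1"
      using assms(2) factor_of_window unfolding balanced_word_def
      by (metis length_map length_upt add_diff_cancel_left')
    then show "count_list (map ((!!) w) [i..<i + N]) x
        \<le> count_list (map ((!!) w) [j..<j + N]) x + 1" by linarith
  qed
  show "rich_fun ((!!) w)"
    unfolding rich_fun_def
  proof (intro allI impI)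
    fix x i j
    assume r: "return_at ((!!) w) x i j"
    let ?v = "map ((!!) w) [i..<Suc j]"
    have ij: "i < j" "w !! i = x" "w !! j = x" using r by (auto simp: return_at_def)
    have len: "length ?v = Suc (j - i)" using ij by (simp add: Suc_diff_le del: upt_Suc)
    have occ: "t \<in> occurrences [x] ?v \<longleftrightarrow> t = 0 \<or> t = j - i" for t
    proof -
      have "t \<in> occurrences [x] ?v \<longleftrightarrow> t \<le> j - i \<and> ?v ! t = x"
        unfolding occurrences_def using len
        by (auto simp: take_Suc_conv_app_nth hd_drop_conv_nth take_Suc simp del: upt_Suc)
      also have "\<dots> \<longleftrightarrow> t \<le> j - i \<and> w !! (i + t) = x"
        using ij by (auto simp del: upt_Suc)
      also have "\<dots> \<longleftrightarrow> t = 0 \<or> t = j - i"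
        using r ij unfolding return_at_def
        by (cases "t = 0 \<or> t = j - i") auto
      finally show ?thesis .
    qed
    then have "occurrences [x] ?v = {0, j - i}" by auto
    then have "card (occurrences [x] ?v) = 2" using ij by simp
    moreover have "prefix [x] ?v" using ij by (simp add: upt_conv_Cons del: upt_Suc)
    moreover have "suffix [x] ?v" using ij by (simp add: suffix_def)
    ultimately have "complete_return w [x] ?v"
      unfolding complete_return_def using factor_of_window by blast
    moreover have "x \<in> sset w" using ij(2) snth_sset by blast
    ultimately show "rev ?v = ?v" using assms(3) unfolding weakly_rich_def palindrome_def by blast
  qed
qed

lemma relabelling_exists:
  assumes "distinct Ls" "set Ls = {1..k}"
  shows "\<exists>\<pi>. \<pi> permutes {1..k} \<and> map \<pi> Ls = [1..<Suc k]"
proof -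
  have len: "length Ls = k" using assms by (metis card_atLeastAtMost diff_Suc_1 distinct_card)
  \<comment> \<open>\<open>s\<close> lists the entries of \<open>Ls\<close>, shifted by one because
    lists are indexed from 0, and fixes everything else; its inverse is the relabelling.\<close>
  define s where "s i = (if i \<in> {1..k} then Ls ! (i - 1) else i)" for i
  have m: "map s [1..<Suc k] = Ls"
    by (rule nth_equalityI) (auto simp: len s_def simp del: upt_Suc)
  have "bij_betw s {1..k} {1..k}"
  proof -
    have "inj_on s (set [1..<Suc k])" using m assms(1) by (metis distinct_map)
    moreover have "s ` set [1..<Suc k] = {1..k}" using m assms(2) by (metis list.set_map)
    moreover have "set [1..<Suc k] = {1..k}" by auto
    ultimately show ?thesis by (simp add: bij_betw_def)
  qed
  then have s: "s permutes {1..k}" by (rule bij_imp_permutes) (auto simp: s_def)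
  then have "map (inv s) Ls = [1..<Suc k]"
    unfolding m[symmetric] by (simp add: permutes_inv_o(2)[OF s] del: upt_Suc)
  then show ?thesis using permutes_inv[OF s] by blast
qed

lemma shift_of_smap: "shift_of x y \<Longrightarrow> shift_of (smap h x) (smap h y)"
  unfolding shift_of_def by (metis sdrop_smap)

theorem theorem5p6:
  fixes k :: nat and w :: "nat stream"
  assumes "k \<ge> 3"
    and "sset w = {1..k}"
    and "recurrent_word w"
    and "balanced_word w"
    and "weakly_rich w"
  shows "\<exists>\<pi>. \<pi> permutes {1..k} \<and>
           ((\<exists>n\<ge>1. periodic_word (word1 k n) \<and> shift_of (smap \<pi> w) (word1 k n)) \<or>
            (\<exists>j. 1 \<le> j \<and> j \<le> k - 2 \<and>
               periodic_word (word2 k j) \<and> shift_of (smap \<pi> w) (word2 k j)))"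
proof -
  have good: "good ((!!) w)" using assms by (intro good_snth)
  have range: "range ((!!) w) = {1..k}" using assms(2) by (simp add: sset_range)
  have w: "to_stream ((!!) w) = w" by (rule stream_eq_snthI) simp
  consider (1) n a L c where "n \<ge> 1" "distinct (a # L @ [c])" "set (a # L @ [c]) = {1..k}"
      "tail_eq w ((psi a ^^ n) (foldr psi L (sconst c)))"
    | (2) J b L c where "J \<noteq> []" "distinct (J @ b # L @ [c])" "set (J @ b # L @ [c]) = {1..k}"
      "tail_eq w (foldr sigma J ((psi b ^^ 2) (foldr psi L (sconst c))))"
    using good_structure[OF _ good] assms(1) unfolding range w by auto
  then show ?thesis
  proof cases
    case 1
    let ?P = "(psi a ^^ n) (foldr psi L (sconst c))"
    obtain \<pi> where \<pi>: "\<pi> permutes {1..k}" "map \<pi> (a # L @ [c]) = [1..<Suc k]"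
      using relabelling_exists[OF 1(2,3)] by blast
    have inj: "inj \<pi>" using \<pi>(1) by (rule permutes_inj)
    have k: "[1..<Suc k] = 1 # [2..<k] @ [k]"
      using assms(1) by (simp add: upt_conv_Cons numeral_2_eq_2)
    have "\<pi> a = 1" "map \<pi> L = [2..<k]" "\<pi> c = k" using \<pi>(2) unfolding k by auto
    then have P: "smap \<pi> ?P = word1 k n"
      by (simp add: word1_def smap_psi_pow[OF inj] smap_foldr_psi[OF inj] smap_sconst)
    have "shift_of w ?P"
      using assms(3) 1(4)
      by (intro recurrent_tail_eq_periodic_imp_shift periodic_psi_pow periodic_foldr_psi periodic_sconst)
    then have "shift_of (smap \<pi> w) (word1 k n)" using shift_of_smap P by metis
    moreover have "periodic_word (word1 k n)"
      unfolding word1_def by (intro periodic_psi_pow periodic_foldr_psi periodic_sconst)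
    ultimately show ?thesis using \<pi>(1) 1(1) by blast
  next
    case 2
    let ?P = "foldr sigma J ((psi b ^^ 2) (foldr psi L (sconst c)))"
    let ?j = "length J"
    obtain \<pi> where \<pi>: "\<pi> permutes {1..k}" "map \<pi> (J @ b # L @ [c]) = [1..<Suc k]"
      using relabelling_exists[OF 2(2,3)] by blast
    have inj: "inj \<pi>" using \<pi>(1) by (rule permutes_inj)
    have len: "?j + 2 + length L = k" using arg_cong[OF \<pi>(2), of length] by simp
    have "[1..<Suc k] = [1..<?j + 1] @ [?j + 1..<Suc k]" using len by (intro upt_split) auto
    also have "[?j + 1..<Suc k] = (?j + 1) # [?j + 2..<k] @ [k]"
      using len by (simp add: upt_conv_Cons)
    finally have k: "map \<pi> J @ \<pi> b # map \<pi> L @ [\<pi> c] = [1..<?j + 1] @ (?j + 1) # [?j + 2..<k] @ [k]"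
      using \<pi>(2) by simp
    \<comment> \<open>Equal lengths of the first parts allow the list equation to be split
      there.\<close>
    have "length (map \<pi> J) = length [1..<?j + 1]" by (simp del: upt_Suc)
    from k[unfolded append_eq_append_conv[OF disjI1[OF this]]]
    have "map \<pi> J = [1..<?j + 1]" "\<pi> b = ?j + 1" "map \<pi> L = [?j + 2..<k]" "\<pi> c = k"
      by auto
    then have P: "smap \<pi> ?P = word2 k ?j"
      unfolding word2_def smap_foldr_sigma[OF inj] smap_psi_pow[OF inj] smap_foldr_psi[OF inj]
        smap_sconst by simp
    have "shift_of w ?P"
      using assms(3) 2(4)
      by (intro recurrent_tail_eq_periodic_imp_shift periodic_foldr_sigma periodic_psi_pow
          periodic_foldr_psi periodic_sconst)
    then have "shift_of (smap \<pi> w) (word2 k ?j)" using shift_of_smap P by metis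
    moreover have "periodic_word (word2 k ?j)"
      unfolding word2_def
      by (intro periodic_foldr_sigma periodic_psi_pow periodic_foldr_psi periodic_sconst)
    moreover have "1 \<le> ?j" using 2(1) by (simp add: Suc_le_eq)
    moreover have "?j \<le> k - 2" using len by linarith
    ultimately show ?thesis using \<pi>(1) by blast
  qed
qed

end
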